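(* Let $n\ge1$, let $\mathcal{E}$ be a Hilbert space, let $L\in\mathcal{B}(\mathcal{E},\mathcal{F}_n^2\otimes\mathcal{E})$, and suppose $(W_L,S^{\mathcal{E}})$ is an isometric representation, i.e. the odometer map $W_L$ is an isometry. Let $\Theta\in H^\infty_{\mathcal{B}(\mathcal{E})}(\mathbb{D})$ be the analytic symbol associated with $W_L$. Then $$\ker M_\Theta^*=U_1(\mathcal{E}_L\ominus L\mathcal{E}),\quad\text{and}\quad\operatorname{mult}(W_L)=\operatorname{mult}(M_\Theta).$$
   Context: Hilbert spaces are separable and complex; $\mathcal{B}(\mathcal{H},\mathcal{K})$ denotes bounded linear operators. $F_n^+$ is the free monoid of words $\mu=\mu_1\cdots\mu_m$ in the letters $1,\dots,n$, with empty word $\emptyset$. The full Fock space $\mathcal{F}_n^2=\mathbb{C}\Omega\oplus\bigoplus_{k\ge1}(\mathbb{C}^n)^{\otimes k}$ has orthonormal basis $e_\mu=e_{\mu_1}\otimes\cdots\otimes e_{\mu_m}$, $\mu\in F_n^+$, with $e_\emptyset=\Omega$; $e_k^m:=e_k^{\otimes m}$, $e_k^0=\Omega$, and $\Omega$ acts as a unit for left tensoring. $S_i f=e_i\otimes f$ is the $i$-th left creation operator on $\mathcal{F}_n^2$, $S^{\mathcal{E}}=(S_1\otimes I_{\mathcal{E}},\dots,S_n\otimes I_{\mathcal{E}})$, and $e_1^p\otimes f$ means $(S_1^p\otimes I_{\mathcal{E}})f$ for $f\in\mathcal{F}_n^2\otimes\mathcal{E}$. Odometer map: for $L\in\mathcal{B}(\mathcal{E},\mathcal{F}_n^2\otimes\mathcal{E})$,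 $W_L$ is the operator on $\mathcal{F}_n^2\otimes\mathcal{E}$ given by $W_L(\Omega\otimes\eta)=L\eta$; $W_L(e_n^m\otimes\eta)=e_1^m\otimes L\eta$ for $m\ge1$; and, for a nonempty word $\mu=\mu_1\cdots\mu_m$ having some letter $\ne n$, with $k$ the smallest index such that $\mu_k\neq n$, $W_L(e_\mu\otimes\eta)=e_1^{k-1}\otimes e_{\mu_k+1}\otimes e_{\mu_{k+1}}\otimes\cdots\otimes e_{\mu_m}\otimes\eta$. The pair $(W_L,S^{\mathcal{E}})$ is a (Fock) representation of the odometer semigroup, called isometric when $W_L$ is a (bounded, everywhere defined) isometry. $\mathcal{E}_L:=\overline{\mathrm{span}}\{e_1^m\otimes\eta:m\ge0,\eta\in\mathcal{E}\}\ominus\overline{\mathrm{span}}\{e_1^p\otimes L\zeta:p\ge1,\zeta\in\mathcal{E}\}$, where $\mathcal{A}\ominus\mathcal{B}$ means $\mathcal{A}\cap\mathcal{B}^\perp$. $\mathcal{M}^\perp:=\overline{\mathrm{span}}\{e_1^m\otimes\xi:m\ge0,\xi\in\mathcal{E}\}$ and $U_1:\mathcal{M}^\perp\to H^2_{\mathcal{E}}(\mathbb{D})$ is the unitary with $U_1(e_1^p\otimes\eta)=z^p\eta$. The analytic symbol associated with $W_L$ is $\Theta(z)=\sum_{r\ge0}z^rL_r\in H^\infty_{\mathcal{B}(\mathcal{E})}(\mathbb{D})$ (bounded analytic $\mathcal{B}(\mathcal{E})$-valued functions on the unit disc), where $L_r=(\langle e_1^r,\cdot\rangle\otimes I_{\mathcal{E}})L$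 and $\langle e_1^r,\cdot\rangle\otimes I_{\mathcal{E}}:\mathcal{F}_n^2\otimes\mathcal{E}\to\mathcal{E}$ sends $e_\mu\otimes\eta$ to $\eta$ if $e_\mu=e_1^r$ and to $0$ otherwise. $M_\Theta f(z)=\Theta(z)f(z)$ on the $\mathcal{E}$-valued Hardy space $H^2_{\mathcal{E}}(\mathbb{D})$; when $W_L$ is an isometry, $M_\Theta$ is an isometry. For an isometry $T$, $\operatorname{mult}(T):=\dim\ker T^*$ (the multiplicity of the shift part in its Wold decomposition). *)

theory Defs
  imports "HOL-Analysis.Analysis" "HOL-Library.Extended_Nat"
begin

section \<open>Complex Hilbert spaces\<close>

text \<open>
  A complex inner product space is presented as a real inner product space (so that norm, metric
  and topology are those of the library) with a complex scalar multiplication and a sesquilinear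
  form whose real part is the real inner product.  The form is linear in its second argument.
\<close>

class complex_inner = real_inner +
  fixes scaleC :: "complex \<Rightarrow> 'a \<Rightarrow> 'a" (infixr "*\<^sub>C" 75)
    and cinner :: "'a \<Rightarrow> 'a \<Rightarrow> complex"
  assumes scaleR_scaleC: "r *\<^sub>R x = complex_of_real r *\<^sub>C x"
    and scaleC_add_right: "a *\<^sub>C (x + y) = a *\<^sub>C x + a *\<^sub>C y"
    and scaleC_add_left: "(a + b) *\<^sub>C x = a *\<^sub>C x + b *\<^sub>C x"
    and scaleC_scaleC: "a *\<^sub>C b *\<^sub>C x = (a * b) *\<^sub>C x"
    and cinner_commute: "cinner x y = cnj (cinner y x)"
    and cinner_add_right: "cinner x (y + z) = cinner x y + cinner x z"
    and cinner_scaleC_right: "cinner x (a *\<^sub>C y) = a * cinner x y"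
    and inner_Re_cinner: "inner x y = Re (cinner x y)"

class complex_hilbert = complex_inner + complete_space

instance complex_hilbert \<subseteq> banach ..

lemma scaleC_one: "1 *\<^sub>C (x::'a::complex_inner) = x"
  using scaleR_scaleC[of 1 x] by simp

global_interpretation complex_vector: vector_space "scaleC :: complex \<Rightarrow> 'a \<Rightarrow> 'a::complex_inner"
  defines cspan = complex_vector.span
  by unfold_locales (simp_all add: scaleC_add_right scaleC_add_left scaleC_scaleC scaleC_one)

lemma cinner_add_left: "cinner (x + y) z = cinner x z + cinner y (z::'a::complex_inner)"
  by (metis cinner_add_right cinner_commute complex_cnj_add)

lemma cinner_scaleC_left: "cinner (a *\<^sub>C x) y = cnj a * cinner x (y::'a::complex_inner)"
  by (metis cinner_scaleC_right cinner_commute complex_cnj_mult)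

lemma cinner_self: "cinner x x = complex_of_real ((norm (x::'a::complex_inner))\<^sup>2)"
proof -
  have "Im (cinner x x) = 0"
    using arg_cong[OF cinner_commute[of x x], of Im] by simp
  then show ?thesis
    by (simp add: complex_eq_iff inner_Re_cinner[symmetric] dot_square_norm)
qed

lemma norm_scaleC: "norm (a *\<^sub>C x) = cmod a * norm (x::'a::complex_inner)"
proof -
  have "complex_of_real ((norm (a *\<^sub>C x))\<^sup>2) = complex_of_real ((cmod a * norm x)\<^sup>2)"
    unfolding cinner_self[symmetric, of "a *\<^sub>C x"] cinner_scaleC_left cinner_scaleC_right
    by (simp only: cinner_self of_real_mult power_mult_distrib complex_norm_square mult_ac)
  then have "(norm (a *\<^sub>C x))\<^sup>2 = (cmod a * norm x)\<^sup>2"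
    by (simp only: of_real_eq_iff)
  then show ?thesis by (simp add: power2_eq_iff_nonneg)
qed

lemma cinner_rotate: "cinner x (y::'a::complex_inner) = Complex (inner x y) (inner (\<i> *\<^sub>C x) y)"
  by (simp add: complex_eq_iff inner_Re_cinner cinner_scaleC_left)

instantiation complex :: complex_hilbert
begin
definition scaleC_complex :: "complex \<Rightarrow> complex \<Rightarrow> complex" where "scaleC_complex a x = a * x"
definition cinner_complex :: "complex \<Rightarrow> complex \<Rightarrow> complex" where "cinner_complex x y = cnj x * y"
instance
  by standard (simp_all add: scaleC_complex_def cinner_complex_def inner_complex_def
      scaleR_conv_of_real algebra_simps)
end

definition bounded_clinear :: "('a::complex_inner \<Rightarrow> 'b::complex_inner) \<Rightarrow> bool" where
  "bounded_clinear T \<longleftrightarrow> bounded_linear T \<and> (\<forall>a x. T (a *\<^sub>C x) = a *\<^sub>C T x)"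

definition isometry :: "('a::complex_inner \<Rightarrow> 'b::complex_inner) \<Rightarrow> bool" where
  "isometry T \<longleftrightarrow> bounded_clinear T \<and> (\<forall>x. norm (T x) = norm x)"

definition cadjoint :: "('a::complex_inner \<Rightarrow> 'b::complex_inner) \<Rightarrow> 'b \<Rightarrow> 'a" where
  "cadjoint T = (SOME T'. \<forall>x y. cinner (T x) y = cinner x (T' y))"

definition ker_op :: "('a::complex_inner \<Rightarrow> 'b::complex_inner) \<Rightarrow> 'a set" where
  "ker_op T = {x. T x = 0}"

definition closed_cspan :: "'a::complex_inner set \<Rightarrow> 'a set" where
  "closed_cspan A = closure (cspan A)"

definition ominus :: "'a::complex_inner set \<Rightarrow> 'a set \<Rightarrow> 'a set" (infixl "\<ominus>" 65) where
  "A \<ominus> B = {x \<in> A. \<forall>y\<in>B. cinner y x = 0}"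

definition orthonormal_basis :: "'a::complex_inner set \<Rightarrow> 'a set \<Rightarrow> bool" where
  "orthonormal_basis B S \<longleftrightarrow>
     (\<forall>x\<in>B. norm x = 1) \<and> (\<forall>x\<in>B. \<forall>y\<in>B. x \<noteq> y \<longrightarrow> cinner x y = 0) \<and> closed_cspan B = S"

text \<open>
  Hilbert space dimension of a closed subspace of a separable space, where \<open>\<infinity>\<close> stands for the
  countably infinite dimension.
\<close>

definition hdim :: "'a::complex_inner set \<Rightarrow> enat" where
  "hdim S = (THE d. \<exists>B. orthonormal_basis B S \<and> d = (if finite B then enat (card B) else \<infinity>))"

definition shift_mult :: "('a::complex_inner \<Rightarrow> 'a) \<Rightarrow> enat" where
  "shift_mult T = hdim (ker_op (cadjoint T))"


section \<open>Square-summable families\<close>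

typedef (overloaded) ('i, 'e::complex_inner) ell2 =
  "{f :: 'i \<Rightarrow> 'e. (\<lambda>i. (norm (f i))\<^sup>2) summable_on UNIV}"
  morphisms coord Abs_ell2
  by (rule exI[of _ "\<lambda>_. 0"]) simp

lemma ell2_summable: "(\<lambda>i. (norm (coord f i))\<^sup>2) summable_on UNIV"
  using coord[of f] by simp

lemma ell2_eqI: "(\<And>i. coord f i = coord g i) \<Longrightarrow> f = g"
  by (simp add: coord_inject[symmetric] fun_eq_iff)

lemma square_summable_bound:
  fixes f :: "'i \<Rightarrow> 'e::real_normed_vector"
  assumes "g summable_on UNIV" "\<And>i. (norm (f i))\<^sup>2 \<le> g i"
  shows "(\<lambda>i. (norm (f i))\<^sup>2) summable_on UNIV"
  by (rule summable_on_comparison_test[OF assms(1)]) (use assms(2) in auto)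

lemma norm_add_square_le:
  fixes x y :: "'e::real_normed_vector"
  shows "(norm (x + y))\<^sup>2 \<le> 2 * (norm x)\<^sup>2 + 2 * (norm y)\<^sup>2"
proof -
  have "(norm (x + y))\<^sup>2 \<le> (norm x + norm y)\<^sup>2"
    by (simp add: norm_triangle_ineq power_mono)
  also have "\<dots> \<le> 2 * (norm x)\<^sup>2 + 2 * (norm y)\<^sup>2"
    using sum_squares_bound[of "norm x" "norm y"] by (simp add: power2_sum)
  finally show ?thesis .
qed

lemma square_summable_add:
  fixes f g :: "'i \<Rightarrow> 'e::real_normed_vector"
  assumes "(\<lambda>i. (norm (f i))\<^sup>2) summable_on UNIV" "(\<lambda>i. (norm (g i))\<^sup>2) summable_on UNIV"
  shows "(\<lambda>i. (norm (f i + g i))\<^sup>2) summable_on UNIV"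
  by (rule square_summable_bound[OF summable_on_add[OF summable_on_cmult_right[OF assms(1), of 2]
          summable_on_cmult_right[OF assms(2), of 2]]])
     (rule norm_add_square_le)

lemma square_summable_scaleC:
  fixes f :: "'i \<Rightarrow> 'e::complex_inner"
  assumes "(\<lambda>i. (norm (f i))\<^sup>2) summable_on UNIV"
  shows "(\<lambda>i. (norm (a *\<^sub>C f i))\<^sup>2) summable_on UNIV"
  using summable_on_cmult_right[OF assms, of "(cmod a)\<^sup>2"]
  by (simp add: norm_scaleC power_mult_distrib)

lemma ell2_cinner_summable:
  "(\<lambda>i. cinner (coord f i) (coord g i :: 'e::complex_inner)) summable_on UNIV"
proof -
  have re: "(\<lambda>i. inner (coord f i) (coord g i)) summable_on UNIV" for f g :: "('i,'e) ell2"
  proof -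
    have "(\<lambda>i. (norm (coord f i + coord g i))\<^sup>2 + - (norm (coord f i))\<^sup>2 + - (norm (coord g i))\<^sup>2)
            summable_on UNIV"
      by (intro summable_on_add summable_on_uminus[THEN iffD2] square_summable_add ell2_summable)
    then have "(\<lambda>i. 2 * inner (coord f i) (coord g i)) summable_on UNIV"
      by (simp add: power2_norm_eq_inner inner_add_left inner_add_right inner_commute)
    from summable_on_cmult_right[OF this, of "1/2"] show ?thesis by simp
  qed
  have 1: "(\<lambda>i. complex_of_real (inner (coord f i) (coord g i))) summable_on UNIV"
    using re by (rule summable_on_of_real)
  have "coord (Abs_ell2 (\<lambda>i. \<i> *\<^sub>C coord f i)) = (\<lambda>i. \<i> *\<^sub>C coord f i)"
    by (subst Abs_ell2_inverse) (auto intro: square_summable_scaleC ell2_summable)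
  with re[of "Abs_ell2 (\<lambda>i. \<i> *\<^sub>C coord f i)" g]
  have "(\<lambda>i. inner (\<i> *\<^sub>C coord f i) (coord g i)) summable_on UNIV" by simp
  then have 2: "(\<lambda>i. \<i> * complex_of_real (inner (\<i> *\<^sub>C coord f i) (coord g i))) summable_on UNIV"
    by (intro summable_on_cmult_right summable_on_of_real)
  show ?thesis
    using summable_on_add[OF 1 2] by (simp add: cinner_rotate Complex_eq)
qed

instantiation ell2 :: (type, complex_inner) complex_inner
begin

definition "0 = Abs_ell2 (\<lambda>_. 0)"
definition "f + g = Abs_ell2 (\<lambda>i. coord f i + coord g i)"
definition "- f = Abs_ell2 (\<lambda>i. - coord f i)"
definition "f - g = Abs_ell2 (\<lambda>i. coord f i - coord g i)"
definition "r *\<^sub>R f = Abs_ell2 (\<lambda>i. r *\<^sub>R coord f i)"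
definition "a *\<^sub>C f = Abs_ell2 (\<lambda>i. a *\<^sub>C coord f i)"
definition "cinner f g = (\<Sum>\<^sub>\<infinity>i. cinner (coord f i) (coord g i))"
definition "inner f g = (\<Sum>\<^sub>\<infinity>i. inner (coord f i) (coord g i))"
definition "norm f = sqrt (\<Sum>\<^sub>\<infinity>i. (norm (coord f i))\<^sup>2)"
definition "dist f g = norm (f - g)" for f g :: "('a,'b) ell2"
definition "sgn f = inverse (norm f) *\<^sub>R f" for f :: "('a,'b) ell2"
definition "uniformity = (INF e\<in>{0<..}. principal {(f::('a,'b) ell2, g). dist f g < e})"
definition
  "open U \<longleftrightarrow> (\<forall>f\<in>U. eventually (\<lambda>(f', g). f' = f \<longrightarrow> g \<in> U) uniformity)" for U :: "('a,'b) ell2 set"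

lemma coord_zero [simp]: "coord 0 i = 0"
  unfolding zero_ell2_def by (subst Abs_ell2_inverse) auto

lemma coord_add [simp]: "coord (f + g) i = coord f i + coord g i"
  unfolding plus_ell2_def by (subst Abs_ell2_inverse) (auto intro: square_summable_add ell2_summable)

lemma coord_uminus [simp]: "coord (- f) i = - coord f i"
  unfolding uminus_ell2_def by (subst Abs_ell2_inverse) (auto intro: ell2_summable)

lemma coord_diff [simp]: "coord (f - g) i = coord f i - coord g i"
  unfolding minus_ell2_def
  using square_summable_add[OF ell2_summable[of f] ell2_summable[of "- g"]]
  by (subst Abs_ell2_inverse) auto

lemma coord_scaleC [simp]: "coord (a *\<^sub>C f) i = a *\<^sub>C coord f i"
  unfolding scaleC_ell2_def by (subst Abs_ell2_inverse) (auto intro: square_summable_scaleC ell2_summable)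

lemma coord_scaleR [simp]: "coord (r *\<^sub>R f) i = r *\<^sub>R coord f i"
  unfolding scaleR_ell2_def scaleR_scaleC
  by (subst Abs_ell2_inverse) (auto intro: square_summable_scaleC ell2_summable)

lemma ell2_inner_summable: "(\<lambda>i. inner (coord f i) (coord g i :: 'b)) summable_on UNIV"
  unfolding inner_Re_cinner by (rule summable_on_Re) (rule ell2_cinner_summable)

instance
proof
  fix f g h :: "('a,'b) ell2" and r s :: real and a b :: complex
  show "f + g + h = f + (g + h)" "f + g = g + f" "0 + f = f" "- f + f = 0" "f - g = f + - g"
    by (rule ell2_eqI; simp)+
  show "r *\<^sub>R (f + g) = r *\<^sub>R f + r *\<^sub>R g" "(r + s) *\<^sub>R f = r *\<^sub>R f + s *\<^sub>R f"
    "r *\<^sub>R s *\<^sub>R f = (r * s) *\<^sub>R f" "1 *\<^sub>R f = f"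
    by (rule ell2_eqI; simp add: scaleR_add_right scaleR_add_left)+
  show "r *\<^sub>R f = complex_of_real r *\<^sub>C f" "a *\<^sub>C (f + g) = a *\<^sub>C f + a *\<^sub>C g"
    "(a + b) *\<^sub>C f = a *\<^sub>C f + b *\<^sub>C f" "a *\<^sub>C b *\<^sub>C f = (a * b) *\<^sub>C f"
    by (rule ell2_eqI; simp add: scaleR_scaleC scaleC_add_right scaleC_add_left scaleC_scaleC)+
  show "dist f g = norm (f - g)" by (rule dist_ell2_def)
  show "sgn f = inverse (norm f) *\<^sub>R f" by (rule sgn_ell2_def)
  show "uniformity = (INF e\<in>{0<..}. principal {(f::('a,'b) ell2, g). dist f g < e})"
    by (rule uniformity_ell2_def)
  show "open U \<longleftrightarrow> (\<forall>f\<in>U. eventually (\<lambda>(f', g). f' = f \<longrightarrow> g \<in> U) uniformity)"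
    for U :: "('a,'b) ell2 set" by (rule open_ell2_def)
  show "inner f g = inner g f" by (simp add: inner_ell2_def inner_commute)
  show "inner (f + g) h = inner f h + inner g h"
    by (simp add: inner_ell2_def inner_add_left infsum_add ell2_inner_summable)
  show "inner (r *\<^sub>R f) g = r * inner f g"
    by (simp add: inner_ell2_def infsum_cmult_right')
  show "0 \<le> inner f f" by (simp add: inner_ell2_def infsum_nonneg)
  show "inner f f = 0 \<longleftrightarrow> f = 0"
  proof
    assume "inner f f = 0"
    then have "inner (coord f i) (coord f i) = 0" for i
      unfolding inner_ell2_def
      using nonneg_infsum_le_0D[of "\<lambda>i. inner (coord f i) (coord f i)" UNIV i] ell2_inner_summable[of f f]
      by simp
    then show "f = 0" by (intro ell2_eqI) simp
  qed (simp add: inner_ell2_def)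
  show "norm f = sqrt (inner f f)"
    by (simp add: norm_ell2_def inner_ell2_def power2_norm_eq_inner)
  show "cinner f g = cnj (cinner g f)"
    by (simp add: cinner_ell2_def infsum_cnj[symmetric] cinner_commute[symmetric] del: infsum_cnj)
  show "cinner f (g + h) = cinner f g + cinner f h"
    by (simp add: cinner_ell2_def cinner_add_right infsum_add ell2_cinner_summable)
  show "cinner f (a *\<^sub>C g) = a * cinner f g"
    by (simp add: cinner_ell2_def cinner_scaleC_right infsum_cmult_right')
  show "inner f g = Re (cinner f g)"
    by (simp add: cinner_ell2_def inner_ell2_def inner_Re_cinner infsum_Re ell2_cinner_summable)
qed

end

lemma norm_ell2_square: "(norm f)\<^sup>2 = (\<Sum>\<^sub>\<infinity>i. (norm (coord f i))\<^sup>2)"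
  by (simp add: norm_ell2_def infsum_nonneg)

lemma sum_coord_le: "finite F \<Longrightarrow> (\<Sum>i\<in>F. (norm (coord f i))\<^sup>2) \<le> (norm f)\<^sup>2"
  unfolding norm_ell2_square by (rule finite_sum_le_infsum) (auto intro: ell2_summable)

lemma norm_coord_le: "norm (coord f i) \<le> norm f"
  using sum_coord_le[of "{i}" f] by (simp add: power2_le_iff_abs_le)

instance ell2 :: (type, complex_hilbert) complex_hilbert
proof
  fix X :: "nat \<Rightarrow> ('a,'b) ell2"
  assume X: "Cauchy X"
  have "Cauchy (\<lambda>n. coord (X n) i)" for i
    unfolding Cauchy_def
  proof (intro allI impI)
    fix e :: real assume "0 < e"
    with X obtain M where M: "\<forall>m\<ge>M. \<forall>n\<ge>M. dist (X m) (X n) < e"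
      unfolding Cauchy_def by blast
    have "dist (coord (X m) i) (coord (X n) i) \<le> dist (X m) (X n)" for m n
      using norm_coord_le[of "X m - X n" i] by (simp add: dist_norm)
    with M show "\<exists>M. \<forall>m\<ge>M. \<forall>n\<ge>M. dist (coord (X m) i) (coord (X n) i) < e"
      by (meson le_less_trans)
  qed
  then have "\<forall>i. \<exists>L. (\<lambda>n. coord (X n) i) \<longlonglongrightarrow> L"
    by (simp add: Cauchy_convergent_iff convergent_def)
  then obtain l where l: "(\<lambda>n. coord (X n) i) \<longlonglongrightarrow> l i" for i
    by metis
  have fin: "(\<Sum>i\<in>F. (norm (coord (X m) i - l i))\<^sup>2) \<le> e\<^sup>2"
    if F: "finite F" and e: "0 < e" and M: "\<forall>n\<ge>M. dist (X m) (X n) < e" for F m M and e :: real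
  proof (rule tendsto_upperbound)
    show "(\<lambda>n. \<Sum>i\<in>F. (norm (coord (X m) i - coord (X n) i))\<^sup>2)
            \<longlonglongrightarrow> (\<Sum>i\<in>F. (norm (coord (X m) i - l i))\<^sup>2)"
      by (intro tendsto_intros l)
    show "\<forall>\<^sub>F n in sequentially. (\<Sum>i\<in>F. (norm (coord (X m) i - coord (X n) i))\<^sup>2) \<le> e\<^sup>2"
      unfolding eventually_sequentially
    proof (intro exI allI impI)
      fix n assume "M \<le> n"
      then have "norm (X m - X n) \<le> e" using M by (simp add: dist_norm less_imp_le)
      then have "(norm (X m - X n))\<^sup>2 \<le> e\<^sup>2" by (intro power_mono) auto
      then show "(\<Sum>i\<in>F. (norm (coord (X m) i - coord (X n) i))\<^sup>2) \<le> e\<^sup>2"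
        using sum_coord_le[OF F, of "X m - X n"] by simp
    qed
  qed simp
  have diff: "(\<lambda>i. (norm (coord (X m) i - l i))\<^sup>2) summable_on UNIV"
    if e: "0 < e" and M: "\<forall>n\<ge>M. dist (X m) (X n) < e" for m M and e :: real
    by (rule nonneg_bdd_above_summable_on) (auto intro!: bdd_aboveI2[of _ _ "e\<^sup>2"] fin[OF _ e M])
  obtain M1 where M1: "\<forall>m\<ge>M1. \<forall>n\<ge>M1. dist (X m) (X n) < 1"
    using X unfolding Cauchy_def by (meson zero_less_one)
  have "(\<lambda>i. (norm (coord (X M1) i - l i))\<^sup>2) summable_on UNIV"
    by (rule diff[of 1 M1]) (use M1 in auto)
  then have "(\<lambda>i. (norm (- (coord (X M1) i - l i) + coord (X M1) i))\<^sup>2) summable_on UNIV"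
    by (intro square_summable_add ell2_summable) (simp add: norm_minus_commute)
  then have "(\<lambda>i. (norm (l i))\<^sup>2) summable_on UNIV" by simp
  then have L: "coord (Abs_ell2 l) = l" by (subst Abs_ell2_inverse) auto
  have "X \<longlonglongrightarrow> Abs_ell2 l"
  proof (rule metric_LIMSEQ_I)
    fix r :: real assume "0 < r"
    then have e: "0 < r / 2" by simp
    with X obtain M where M: "\<forall>m\<ge>M. \<forall>n\<ge>M. dist (X m) (X n) < r / 2"
      unfolding Cauchy_def by blast
    show "\<exists>M. \<forall>m\<ge>M. dist (X m) (Abs_ell2 l) < r"
    proof (intro exI allI impI)
      fix m assume "M \<le> m"
      then have Mm: "\<forall>n\<ge>M. dist (X m) (X n) < r / 2" using M by blast
      have "(norm (X m - Abs_ell2 l))\<^sup>2 \<le> (r / 2)\<^sup>2"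
        unfolding norm_ell2_square coord_diff L
        by (rule infsum_le_finite_sums[OF diff[OF e Mm]]) (auto intro: fin[OF _ e Mm])
      then have "dist (X m) (Abs_ell2 l) \<le> r / 2"
        using e by (simp add: dist_norm abs_le_square_iff[symmetric])
      then show "dist (X m) (Abs_ell2 l) < r" using e by linarith
    qed
  qed
  then show "convergent X" by (rule convergentI)
qed

definition ell2_single :: "'i \<Rightarrow> 'e::complex_inner \<Rightarrow> ('i, 'e) ell2" where
  "ell2_single i x = Abs_ell2 (\<lambda>j. if j = i then x else 0)"

lemma coord_single: "coord (ell2_single i x) j = (if j = i then x else 0)"
proof -
  have "(\<lambda>j. (norm (if j = i then x else 0))\<^sup>2) summable_on UNIV"
    by (rule finite_nonzero_values_imp_summable_on) (auto simp: if_distrib cong: if_cong)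
  then show ?thesis unfolding ell2_single_def by (subst Abs_ell2_inverse) auto
qed


section \<open>The Hardy space of the disc\<close>

text \<open>
  Elements are the functions on the unit disc themselves, extended by \<open>0\<close> to the whole plane so
  that equality is equality on the disc.
\<close>

typedef (overloaded) 'e hardy =
  "{f :: complex \<Rightarrow> 'e::complex_hilbert.
     \<exists>a. (\<lambda>k. (norm (a k))\<^sup>2) summable_on (UNIV :: nat set) \<and>
         (\<forall>z. f z = (if norm z < 1 then \<Sum>k. z ^ k *\<^sub>C a k else 0))}"
  morphisms hardy_fun Abs_hardy
  by (intro exI[of _ "\<lambda>_. 0"]) (auto intro!: exI[of _ "\<lambda>_. 0"] simp: complex_vector.scale_zero_right)

definition disc_series :: "(nat, 'e::complex_hilbert) ell2 \<Rightarrow> complex \<Rightarrow> 'e" where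
  "disc_series a z = (if norm z < 1 then \<Sum>k. z ^ k *\<^sub>C coord a k else 0)"

definition taylor :: "'e::complex_hilbert hardy \<Rightarrow> (nat, 'e) ell2" where
  "taylor f = (THE a. hardy_fun f = disc_series a)"

lemma disc_series_summable:
  fixes a :: "(nat, 'e::complex_hilbert) ell2"
  assumes "norm z < 1"
  shows "summable (\<lambda>k. z ^ k *\<^sub>C coord a k)"
proof (rule summable_comparison_test)
  show "\<exists>N. \<forall>n\<ge>N. norm (z ^ n *\<^sub>C coord a n) \<le> norm a * norm z ^ n"
    by (auto simp: norm_scaleC norm_power mult.commute[of "norm a"] intro!: mult_left_mono norm_coord_le)
  show "summable (\<lambda>n. norm a * norm z ^ n)"
    by (intro summable_mult summable_geometric) (use assms in auto)
qed

lemma disc_series_add: "disc_series (a + b) z = disc_series a z + disc_series b z"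
  by (auto simp: disc_series_def scaleC_add_right suminf_add disc_series_summable)

lemma bounded_linear_scaleC: "bounded_linear (\<lambda>x. c *\<^sub>C x :: 'e::complex_inner)"
  by (rule bounded_linear_intro[where K = "cmod c"])
     (simp_all add: scaleC_add_right scaleR_scaleC scaleC_scaleC norm_scaleC mult.commute)

lemma bounded_linear_cinner: "bounded_linear (\<lambda>x. cinner v (x :: 'e::complex_inner))"
proof (rule bounded_linear_intro)
  fix x y :: 'e and r :: real
  show "cinner v (x + y) = cinner v x + cinner v y" by (rule cinner_add_right)
  show "cinner v (r *\<^sub>R x) = r *\<^sub>R cinner v x"
    by (simp add: scaleR_scaleC cinner_scaleC_right scaleR_conv_of_real scaleC_complex_def)
  have "cmod (cinner v x) \<le> \<bar>inner v x\<bar> + \<bar>inner (\<i> *\<^sub>C v) x\<bar>"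
    unfolding cinner_rotate by (simp add: cmod_def sqrt_sum_squares_le_sum_abs)
  also have "\<dots> \<le> norm v * norm x + norm (\<i> *\<^sub>C v) * norm x"
    by (intro add_mono Cauchy_Schwarz_ineq2)
  finally show "cmod (cinner v x) \<le> norm x * (2 * norm v)"
    by (simp add: norm_scaleC algebra_simps)
qed

lemma disc_series_scaleC: "disc_series (c *\<^sub>C a) z = c *\<^sub>C disc_series a z"
proof (cases "norm z < 1")
  case True
  have "disc_series (c *\<^sub>C a) z = (\<Sum>k. c *\<^sub>C (z ^ k *\<^sub>C coord a k))"
    using True by (simp add: disc_series_def scaleC_scaleC mult.commute)
  also have "\<dots> = c *\<^sub>C (\<Sum>k. z ^ k *\<^sub>C coord a k)"
    by (rule bounded_linear.suminf[OF bounded_linear_scaleC disc_series_summable[OF True], symmetric])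
  finally show ?thesis using True by (simp add: disc_series_def)
qed (simp add: disc_series_def complex_vector.scale_zero_right)

lemma disc_series_eq_0:
  assumes "\<And>z. disc_series a z = 0"
  shows "a = 0"
proof (rule ell2_eqI)
  fix n
  define v where "v = coord a n"
  define F where "F = Abs_fps (\<lambda>k. cinner v (coord a k))"
  have s: "(\<lambda>k. cinner v (coord a k) * z ^ k) sums 0" if "norm z < 1" for z
  proof -
    have "(\<lambda>k. z ^ k *\<^sub>C coord a k) sums 0"
      using assms[of z] disc_series_summable[OF that, of a] that
      by (simp add: disc_series_def sums_iff)
    from bounded_linear.sums[OF bounded_linear_cinner this, of v]
    have "(\<lambda>k. z ^ k * cinner v (coord a k)) sums cinner v 0"
      by (simp only: cinner_scaleC_right)
    moreover have "cinner v 0 = 0"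
      by (simp add: cinner_rotate Complex_eq_0)
    ultimately show ?thesis by (simp only: mult.commute)
  qed
  have "ereal (norm (1/2 :: complex)) \<le> conv_radius (fps_nth F)"
    by (rule conv_radius_geI) (use s[of "1/2"] in \<open>simp add: F_def sums_iff\<close>)
  then have r: "0 < fps_conv_radius F"
    unfolding fps_conv_radius_def by (rule less_le_trans[rotated]) simp
  have "F = 0"
  proof (rule eval_fps_eqD)
    show "\<forall>\<^sub>F z in nhds 0. eval_fps F z = eval_fps 0 z"
      unfolding eventually_nhds
      by (rule exI[of _ "ball 0 1"]) (use s in \<open>auto simp: eval_fps_def F_def sums_iff\<close>)
  qed (use r in auto)
  then have "cinner v v = 0"
    by (metis F_def fps_nth_Abs_fps fps_zero_nth v_def)
  then show "coord a n = coord 0 n" by (simp add: cinner_self v_def)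
qed

lemma disc_series_inject:
  assumes "disc_series a = disc_series b"
  shows "a = b"
proof -
  have "disc_series (a + (-1) *\<^sub>C b) z = 0" for z
    unfolding disc_series_add disc_series_scaleC assms by simp
  then have "a + (-1) *\<^sub>C b = 0" by (rule disc_series_eq_0)
  then show ?thesis by simp
qed

lemma hardy_fun_Abs: "hardy_fun (Abs_hardy (disc_series a)) = disc_series a"
  by (rule Abs_hardy_inverse) (auto simp: disc_series_def intro!: exI[of _ "coord a"] ell2_summable)

lemma hardy_fun_taylor: "hardy_fun f = disc_series (taylor f)"
proof -
  from hardy_fun[of f] obtain a where a: "(\<lambda>k. (norm (a k))\<^sup>2) summable_on (UNIV :: nat set)"
    "\<And>z. hardy_fun f z = (if norm z < 1 then \<Sum>k. z ^ k *\<^sub>C a k else 0)" by blast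
  then have "hardy_fun f = disc_series (Abs_ell2 a)"
    by (simp add: fun_eq_iff disc_series_def Abs_ell2_inverse)
  then show ?thesis
    unfolding taylor_def by (rule theI) (metis disc_series_inject \<open>hardy_fun f = _\<close>)
qed

lemma taylor_eqI: "hardy_fun f = disc_series a \<Longrightarrow> taylor f = a"
  using hardy_fun_taylor[of f] disc_series_inject by metis

lemma taylor_Abs: "taylor (Abs_hardy (disc_series a)) = a"
  by (rule taylor_eqI) (rule hardy_fun_Abs)

lemma taylor_inject: "taylor f = taylor g \<Longrightarrow> f = g"
  by (metis hardy_fun_inverse hardy_fun_taylor)

instantiation hardy :: (complex_hilbert) complex_inner
begin

definition "0 = Abs_hardy (\<lambda>_. 0)"
definition "f + g = Abs_hardy (\<lambda>z. hardy_fun f z + hardy_fun g z)"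
definition "- f = Abs_hardy (\<lambda>z. - hardy_fun f z)"
definition "f - g = Abs_hardy (\<lambda>z. hardy_fun f z - hardy_fun g z)"
definition "r *\<^sub>R f = Abs_hardy (\<lambda>z. r *\<^sub>R hardy_fun f z)"
definition "c *\<^sub>C f = Abs_hardy (\<lambda>z. c *\<^sub>C hardy_fun f z)"
definition "cinner f g = cinner (taylor f) (taylor g)"
definition "inner f g = inner (taylor f) (taylor g)"
definition "norm f = norm (taylor f)"
definition "dist f g = norm (f - g)" for f g :: "'a hardy"
definition "sgn f = inverse (norm f) *\<^sub>R f" for f :: "'a hardy"
definition "uniformity = (INF e\<in>{0<..}. principal {(f::'a hardy, g). dist f g < e})"
definition
  "open U \<longleftrightarrow> (\<forall>f\<in>U. eventually (\<lambda>(f', g). f' = f \<longrightarrow> g \<in> U) uniformity)" for U :: "'a hardy set"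

lemma taylor_zero [simp]: "taylor 0 = 0"
proof -
  have "(\<lambda>_. 0) = disc_series (0 :: (nat, 'a) ell2)"
    by (simp add: fun_eq_iff disc_series_def complex_vector.scale_zero_right)
  then show ?thesis unfolding zero_hardy_def by (simp add: taylor_Abs)
qed

lemma taylor_add [simp]: "taylor (f + g) = taylor f + taylor g"
proof -
  have "(\<lambda>z. hardy_fun f z + hardy_fun g z) = disc_series (taylor f + taylor g)"
    by (simp add: fun_eq_iff hardy_fun_taylor disc_series_add)
  then show ?thesis unfolding plus_hardy_def by (simp add: taylor_Abs)
qed

lemma taylor_scaleC [simp]: "taylor (c *\<^sub>C f) = c *\<^sub>C taylor f"
proof -
  have "(\<lambda>z. c *\<^sub>C hardy_fun f z) = disc_series (c *\<^sub>C taylor f)"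
    by (simp add: fun_eq_iff hardy_fun_taylor disc_series_scaleC)
  then show ?thesis unfolding scaleC_hardy_def by (simp add: taylor_Abs)
qed

lemma taylor_scaleR [simp]: "taylor (r *\<^sub>R f) = r *\<^sub>R taylor f"
  using taylor_scaleC[of "complex_of_real r" f]
  by (simp add: scaleR_hardy_def scaleC_hardy_def scaleR_scaleC)

lemma taylor_uminus [simp]: "taylor (- f) = - taylor f"
  using taylor_scaleC[of "-1" f]
  by (simp add: uminus_hardy_def scaleC_hardy_def scaleC_one)

lemma taylor_diff [simp]: "taylor (f - g) = taylor f - taylor g"
proof -
  have "(\<lambda>z. hardy_fun f z - hardy_fun g z) = disc_series (taylor f + (-1) *\<^sub>C taylor g)"
    by (simp only: fun_eq_iff hardy_fun_taylor disc_series_add disc_series_scaleC)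
       (simp add: scaleC_one)
  then show ?thesis unfolding minus_hardy_def by (simp add: taylor_Abs scaleC_one)
qed

instance
proof
  fix f g h :: "'a hardy" and r s :: real and a b :: complex
  show "f + g + h = f + (g + h)" "f + g = g + f" "0 + f = f" "- f + f = 0" "f - g = f + - g"
    by (rule taylor_inject; simp)+
  show "r *\<^sub>R (f + g) = r *\<^sub>R f + r *\<^sub>R g" "(r + s) *\<^sub>R f = r *\<^sub>R f + s *\<^sub>R f"
    "r *\<^sub>R s *\<^sub>R f = (r * s) *\<^sub>R f" "1 *\<^sub>R f = f"
    by (rule taylor_inject; simp add: scaleR_add_right scaleR_add_left)+
  show "r *\<^sub>R f = complex_of_real r *\<^sub>C f" "a *\<^sub>C (f + g) = a *\<^sub>C f + a *\<^sub>C g"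
    "(a + b) *\<^sub>C f = a *\<^sub>C f + b *\<^sub>C f" "a *\<^sub>C b *\<^sub>C f = (a * b) *\<^sub>C f"
    by (rule taylor_inject; simp add: scaleR_scaleC scaleC_add_right scaleC_add_left scaleC_scaleC)+
  show "dist f g = norm (f - g)" by (rule dist_hardy_def)
  show "sgn f = inverse (norm f) *\<^sub>R f" by (rule sgn_hardy_def)
  show "uniformity = (INF e\<in>{0<..}. principal {(f::'a hardy, g). dist f g < e})"
    by (rule uniformity_hardy_def)
  show "open U \<longleftrightarrow> (\<forall>f\<in>U. eventually (\<lambda>(f', g). f' = f \<longrightarrow> g \<in> U) uniformity)"
    for U :: "'a hardy set" by (rule open_hardy_def)
  show "inner f g = inner g f" by (simp add: inner_hardy_def inner_commute)
  show "inner (f + g) h = inner f h + inner g h"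
    "inner (r *\<^sub>R f) g = r * inner f g" "0 \<le> inner f f" "norm f = sqrt (inner f f)"
    by (simp_all add: inner_hardy_def norm_hardy_def inner_add_left norm_eq_sqrt_inner)
  show "inner f f = 0 \<longleftrightarrow> f = 0"
    using taylor_inject[of f 0] by (auto simp: inner_hardy_def)
  show "cinner f g = cnj (cinner g f)" "cinner f (g + h) = cinner f g + cinner f h"
    "cinner f (a *\<^sub>C g) = a * cinner f g" "inner f g = Re (cinner f g)"
    by (simp_all add: cinner_hardy_def inner_hardy_def cinner_add_right cinner_scaleC_right
          inner_Re_cinner cinner_commute[symmetric])
qed

end

lemma dist_taylor: "dist (taylor f) (taylor g) = dist f g"
  by (simp add: dist_norm norm_hardy_def)

instance hardy :: (complex_hilbert) complex_hilbert
proof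
  fix X :: "nat \<Rightarrow> 'a hardy"
  assume "Cauchy X"
  then have "Cauchy (\<lambda>n. taylor (X n))" by (simp add: Cauchy_def dist_taylor)
  then obtain a where "(\<lambda>n. taylor (X n)) \<longlonglongrightarrow> a"
    by (auto simp: Cauchy_convergent_iff convergent_def)
  then have "(\<lambda>n. taylor (X n)) \<longlonglongrightarrow> taylor (Abs_hardy (disc_series a))" by (simp add: taylor_Abs)
  then have "X \<longlonglongrightarrow> Abs_hardy (disc_series a)"
    unfolding tendsto_dist_iff[of _ "Abs_hardy (disc_series a)"]
      tendsto_dist_iff[of _ "taylor (Abs_hardy (disc_series a))"] dist_taylor .
  then show "convergent X" by (rule convergentI)
qed

text \<open>
  \<open>M\<^sub>\<Theta>\<close>, for bounded analytic \<open>\<Theta>\<close>: then \<open>z \<mapsto> \<Theta> z (f z)\<close> is again in the Hardy space.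
\<close>

definition mult_op :: "(complex \<Rightarrow> 'e \<Rightarrow> 'e) \<Rightarrow> 'e::complex_hilbert hardy \<Rightarrow> 'e hardy" where
  "mult_op \<Theta> f = Abs_hardy (\<lambda>z. if norm z < 1 then \<Theta> z (hardy_fun f z) else 0)"


section \<open>The full Fock space and its tensor product with a Hilbert space\<close>

text \<open>
  The \<open>n\<close> letters are the elements of a finite linearly ordered type \<open>'n\<close> (so \<open>n = CARD('n) \<ge> 1\<close>);
  \<open>1\<close>, \<open>n\<close> and \<open>i + 1\<close> are the least letter, the greatest letter and the successor of \<open>i\<close>.
  The Fock space is \<open>\<ell>\<^sup>2\<close> over the words, and \<open>f \<mapsto> (coord f \<mu>)\<^sub>\<mu>\<close> are the coordinates with respect
  to the basis \<open>e\<^sub>\<mu>\<close>.  Its Hilbert tensor product with \<open>\<E>\<close> is the space of square-summable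
  \<open>\<E>\<close>-valued families over the words.
\<close>

definition first_letter :: "'n::{finite,linorder}" where
  "first_letter = Min UNIV"

definition last_letter :: "'n::{finite,linorder}" where
  "last_letter = Max UNIV"

definition next_letter :: "'n::{finite,linorder} \<Rightarrow> 'n" where
  "next_letter i = Min {j. i < j}"

type_synonym 'n fock = "('n list, complex) ell2"
type_synonym ('n, 'e) fock_tensor = "('n list, 'e) ell2"

definition fock_basis :: "'n list \<Rightarrow> 'n fock" where
  "fock_basis \<mu> = ell2_single \<mu> 1"

definition first_power :: "nat \<Rightarrow> 'n::{finite,linorder} list" where
  "first_power m = replicate m first_letter"

definition tensor :: "'n fock \<Rightarrow> 'e::complex_inner \<Rightarrow> ('n, 'e) fock_tensor" (infixr "\<otimes>" 70) where
  "f \<otimes> \<eta> = Abs_ell2 (\<lambda>\<mu>. coord f \<mu> *\<^sub>C \<eta>)"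

lemma coord_tensor: "coord (f \<otimes> \<eta>) \<mu> = coord f \<mu> *\<^sub>C \<eta>"
proof -
  have "(\<lambda>\<mu>. (norm (coord f \<mu> *\<^sub>C \<eta>))\<^sup>2) summable_on UNIV"
    using summable_on_cmult_left[OF ell2_summable[of f], of "(norm \<eta>)\<^sup>2"]
    by (simp add: norm_scaleC power_mult_distrib)
  then show ?thesis unfolding tensor_def by (subst Abs_ell2_inverse) auto
qed

lemma tensor_basis: "fock_basis \<mu> \<otimes> \<eta> = ell2_single \<mu> \<eta>"
  by (rule ell2_eqI)
     (simp add: coord_tensor fock_basis_def coord_single scaleC_one complex_vector.scale_zero_left)

lemma cinner_tensor: "cinner (f \<otimes> \<eta>) (g \<otimes> \<zeta>) = cinner f g * cinner \<eta> \<zeta>"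
proof -
  have "cinner (f \<otimes> \<eta>) (g \<otimes> \<zeta>) = (\<Sum>\<^sub>\<infinity>\<mu>. cinner (coord f \<mu>) (coord g \<mu>) * cinner \<eta> \<zeta>)"
    by (simp add: cinner_ell2_def coord_tensor cinner_scaleC_left cinner_scaleC_right
        cinner_complex_def mult_ac)
  also have "\<dots> = cinner f g * cinner \<eta> \<zeta>"
    by (simp add: cinner_ell2_def infsum_cmult_left')
  finally show ?thesis .
qed

lemma norm_diff_finite_part:
  assumes "finite F"
  shows "(norm (f - (\<Sum>i\<in>F. ell2_single i (coord f i))))\<^sup>2 = (norm f)\<^sup>2 - (\<Sum>i\<in>F. (norm (coord f i))\<^sup>2)"
  using assms
proof (induction F rule: finite_induct)
  case (insert j F)
  define g where "g = f - (\<Sum>i\<in>F. ell2_single i (coord f i))"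
  have sum: "coord (\<Sum>i\<in>F. h i) k = (\<Sum>i\<in>F. coord (h i) k)"
    for h :: "'a \<Rightarrow> ('a, 'b) ell2" and k
    using insert.hyps(1) by (induction F rule: finite_induct) auto
  have gj: "coord g j = coord f j"
    using insert.hyps by (simp add: g_def sum coord_single)
  have single: "inner h (ell2_single j x) = inner (coord h j) x" for h :: "('a, 'b) ell2" and x
  proof -
    have "inner h (ell2_single j x) = (\<Sum>\<^sub>\<infinity>i\<in>{j}. inner (coord h i) x)"
      unfolding inner_ell2_def by (rule infsum_cong_neutral) (auto simp: coord_single)
    then show ?thesis by simp
  qed
  have "(norm (g - ell2_single j (coord f j)))\<^sup>2 = (norm g)\<^sup>2 - (norm (coord f j))\<^sup>2"
    by (simp add: power2_norm_eq_inner inner_diff_left inner_diff_right single gj coord_single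
        inner_commute[of "ell2_single j _" g])
  then show ?case
    using insert by (simp add: g_def diff_diff_eq algebra_simps)
qed simp

lemma tensor_total: "closed_cspan {fock_basis \<mu> \<otimes> \<eta> |\<mu> \<eta>. True} = UNIV"
proof -
  have "f \<in> closed_cspan {fock_basis \<mu> \<otimes> \<eta> |\<mu> \<eta>. True}" for f :: "('a, 'b) fock_tensor"
    unfolding closed_cspan_def closure_approachable
  proof (intro allI impI)
    fix e :: real assume e: "0 < e"
    have "((\<lambda>i. (norm (coord f i))\<^sup>2) has_sum (norm f)\<^sup>2) UNIV"
      unfolding norm_ell2_square by (rule has_sum_infsum) (rule ell2_summable)
    then have "\<forall>\<^sub>F F in finite_subsets_at_top UNIV. dist (\<Sum>i\<in>F. (norm (coord f i))\<^sup>2) ((norm f)\<^sup>2) < e\<^sup>2"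
      unfolding has_sum_def using e by (intro tendstoD) auto
    then obtain F where F: "finite F" "dist (\<Sum>i\<in>F. (norm (coord f i))\<^sup>2) ((norm f)\<^sup>2) < e\<^sup>2"
      unfolding eventually_finite_subsets_at_top by blast
    let ?g = "\<Sum>i\<in>F. ell2_single i (coord f i)"
    have "(norm (f - ?g))\<^sup>2 < e\<^sup>2"
      using F by (simp add: norm_diff_finite_part dist_real_def)
    then have "dist ?g f < e"
      using e by (simp add: dist_norm norm_minus_commute power2_less_imp_less)
    moreover have "?g \<in> cspan {fock_basis \<mu> \<otimes> \<eta> |\<mu> \<eta>. True}"
      by (intro complex_vector.span_sum complex_vector.span_base) (auto simp flip: tensor_basis)
    ultimately show "\<exists>y\<in>cspan {fock_basis \<mu> \<otimes> \<eta> |\<mu> \<eta>. True}. dist y f < e" by blast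
  qed
  then show ?thesis by blast
qed

text \<open>
  \<open>S\<^sub>i \<otimes> I\<close> on \<open>\<F>\<^sup>2 \<otimes> \<E>\<close>; for \<open>\<E> = \<complex>\<close> this is \<open>S\<^sub>i\<close> itself.  Lemma \<open>creation_tensor\<close> below is its
  usual description.
\<close>

definition creation :: "'n \<Rightarrow> ('n, 'e::complex_inner) fock_tensor \<Rightarrow> ('n, 'e) fock_tensor" where
  "creation i f =
     Abs_ell2 (\<lambda>\<mu>. case \<mu> of [] \<Rightarrow> 0 | j # \<nu> \<Rightarrow> if j = i then coord f \<nu> else 0)"

lemma coord_creation:
  "coord (creation i f) \<mu> = (case \<mu> of [] \<Rightarrow> 0 | j # \<nu> \<Rightarrow> if j = i then coord f \<nu> else 0)"
proof -
  let ?g = "\<lambda>\<mu>. case \<mu> of [] \<Rightarrow> 0 | j # \<nu> \<Rightarrow> if j = i then coord f \<nu> else 0"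
  have "(\<lambda>\<mu>. (norm (?g \<mu>))\<^sup>2) summable_on (#) i ` UNIV"
    by (subst summable_on_reindex) (auto simp: o_def ell2_summable)
  then have "(\<lambda>\<mu>. (norm (?g \<mu>))\<^sup>2) summable_on UNIV"
    by (rule summable_on_cong_neutral[THEN iffD1, rotated -1]) (auto split: list.splits)
  then show ?thesis unfolding creation_def by (subst Abs_ell2_inverse) auto
qed

lemma creation_basis: "creation i (fock_basis \<mu>) = fock_basis (i # \<mu>)"
  by (rule ell2_eqI) (auto simp: coord_creation fock_basis_def coord_single split: list.splits)

lemma creation_tensor: "creation i (f \<otimes> \<eta>) = creation i f \<otimes> \<eta>"
  by (rule ell2_eqI)
     (auto simp: coord_creation coord_tensor complex_vector.scale_zero_left split: list.splits)

definition shift :: "nat \<Rightarrow> ('n::{finite,linorder}, 'e::complex_inner) fock_tensor \<Rightarrow> ('n, 'e) fock_tensor" where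
  "shift p = creation first_letter ^^ p"

lemma shift_basis: "shift p (fock_basis \<mu> \<otimes> \<eta>) = fock_basis (first_power p @ \<mu>) \<otimes> \<eta>"
  by (induction p)
     (auto simp: shift_def first_power_def creation_tensor creation_basis)


section \<open>The odometer map and its symbol\<close>

text \<open>
  \<open>odometer_value L \<mu> \<eta>\<close> is the prescribed value of \<open>W\<^sub>L\<close> on \<open>e\<^sub>\<mu> \<otimes> \<eta>\<close>.  In the last case \<open>k\<close> is
  the index, counted from \<open>0\<close>, of the first letter of \<open>\<mu>\<close> that differs from \<open>n\<close>.
\<close>

definition odometer_value ::
  "('e::complex_inner \<Rightarrow> ('n::{finite,linorder}, 'e) fock_tensor) \<Rightarrow> 'n list \<Rightarrow> 'e \<Rightarrow> ('n, 'e) fock_tensor"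
where
  "odometer_value L \<mu> \<eta> =
     (if \<mu> = [] then L \<eta>
      else if \<forall>i\<in>set \<mu>. i = last_letter then shift (length \<mu>) (L \<eta>)
      else let k = (LEAST k. k < length \<mu> \<and> \<mu> ! k \<noteq> last_letter)
           in fock_basis (first_power k @ next_letter (\<mu> ! k) # drop (Suc k) \<mu>) \<otimes> \<eta>)"

text \<open>
  A bounded operator is determined by its values on the vectors \<open>e\<^sub>\<mu> \<otimes> \<eta>\<close>, so there is at most one
  \<open>W\<close> with \<open>odometer_map L W\<close>; there is one exactly when \<open>W\<^sub>L\<close> is bounded.
\<close>

definition odometer_map ::
  "('e::complex_inner \<Rightarrow> ('n::{finite,linorder}, 'e) fock_tensor) \<Rightarrow>
   (('n, 'e) fock_tensor \<Rightarrow> ('n, 'e) fock_tensor) \<Rightarrow> bool"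
where
  "odometer_map L W \<longleftrightarrow>
     bounded_clinear W \<and> (\<forall>\<mu> \<eta>. W (fock_basis \<mu> \<otimes> \<eta>) = odometer_value L \<mu> \<eta>)"

text \<open>The operator \<open>\<langle>f, \<cdot>\<rangle> \<otimes> I\<close> for \<open>f = e\<^sub>\<mu>\<close>.\<close>

definition slice :: "'n list \<Rightarrow> ('n, 'e::complex_inner) fock_tensor \<Rightarrow> 'e" where
  "slice \<mu> f = coord f \<mu>"

lemma slice_basis: "slice \<nu> (fock_basis \<mu> \<otimes> \<eta>) = (if \<mu> = \<nu> then \<eta> else 0)"
  by (simp add: slice_def tensor_basis coord_single)

definition symbol_coeff ::
  "('e::complex_inner \<Rightarrow> ('n::{finite,linorder}, 'e) fock_tensor) \<Rightarrow> nat \<Rightarrow> 'e \<Rightarrow> 'e" where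
  "symbol_coeff L r \<eta> = slice (first_power r) (L \<eta>)"

definition symbol ::
  "('e::complex_hilbert \<Rightarrow> ('n::{finite,linorder}, 'e) fock_tensor) \<Rightarrow> complex \<Rightarrow> 'e \<Rightarrow> 'e" where
  "symbol L z \<eta> = (\<Sum>r. z ^ r *\<^sub>C symbol_coeff L r \<eta>)"

definition M_perp :: "('n::{finite,linorder}, 'e::complex_inner) fock_tensor set" where
  "M_perp = closed_cspan {fock_basis (first_power m) \<otimes> \<eta> |m \<eta>. True}"

definition E_space ::
  "('e::complex_inner \<Rightarrow> ('n::{finite,linorder}, 'e) fock_tensor) \<Rightarrow> ('n, 'e) fock_tensor set" where
  "E_space L = M_perp \<ominus> closed_cspan {shift p (L \<zeta>) |p \<zeta>. 1 \<le> p}"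

text \<open>
  The unitary \<open>U\<^sub>1\<close> from \<open>M_perp\<close> onto the Hardy space; values outside \<open>M_perp\<close> are irrelevant.
\<close>

definition U1 :: "('n::{finite,linorder}, 'e::complex_hilbert) fock_tensor \<Rightarrow> 'e hardy" where
  "U1 f = Abs_hardy (\<lambda>z. if norm z < 1 then \<Sum>p. z ^ p *\<^sub>C slice (first_power p) f else 0)"

lemma U1_basis:
  fixes \<eta> :: "'e::complex_hilbert"
  assumes "norm z < 1"
  shows "hardy_fun (U1 (fock_basis (first_power p :: 'n::{finite,linorder} list) \<otimes> \<eta>)) z = z ^ p *\<^sub>C \<eta>"
proof -
  have inj: "first_power p = (first_power k :: 'n list) \<longleftrightarrow> k = p" for k
    by (metis first_power_def length_replicate)
  have "U1 (fock_basis (first_power p :: 'n list) \<otimes> \<eta>) = Abs_hardy (disc_series (ell2_single p \<eta>))"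
    unfolding U1_def
    by (rule arg_cong[of _ _ Abs_hardy]) (auto simp: fun_eq_iff disc_series_def slice_basis coord_single inj)
  then have "hardy_fun (U1 (fock_basis (first_power p :: 'n list) \<otimes> \<eta>)) z
      = (\<Sum>k. z ^ k *\<^sub>C (if k = p then \<eta> else 0))"
    using assms by (simp add: hardy_fun_Abs disc_series_def coord_single)
  also have "\<dots> = (\<Sum>k\<in>{p}. z ^ k *\<^sub>C (if k = p then \<eta> else 0))"
    by (rule suminf_finite) (auto simp: complex_vector.scale_zero_right)
  finally show ?thesis by simp
qed

end

theory Submission
  imports Defs
begin

text \<open>
  The odometer sends the words that are not powers of the letter \<open>n\<close> bijectively onto the words that
  are not powers of the letter \<open>1\<close>, and sends \<open>e\<^sub>n\<^sup>m \<otimes> \<eta>\<close> to \<open>e\<^sub>1\<^sup>m \<otimes> L\<eta>\<close>.  Hence a vector is orthogonal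
  to the range of \<open>W\<^sub>L\<close> iff it lies in \<open>M\<^sup>\<bottom>\<close> and is orthogonal to all \<open>e\<^sub>1\<^sup>m \<otimes> L\<eta>\<close>, that is, iff it
  lies in \<open>\<E>\<^sub>L \<ominus> L\<E>\<close>.  In terms of Taylor coefficients, \<open>M\<^sub>\<Theta>\<close> is \<open>W\<^sub>L\<close> restricted to the powers of
  \<open>n\<close> and compressed to the powers of \<open>1\<close>, so \<open>U\<^sub>1\<^sup>*\<close>, an isometry defined on the whole Hardy space,
  carries \<open>ker M\<^sub>\<Theta>\<^sup>*\<close> onto \<open>ker W\<^sub>L\<^sup>*\<close>.
\<close>

section \<open>Adjoints of bounded operators\<close>

text \<open>The representing vector is the minimizer of \<open>\<parallel>x\<parallel>\<^sup>2 / 2 - \<phi> x\<close>.\<close>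

lemma riesz_representation:
  fixes \<phi> :: "'a::{real_inner, complete_space} \<Rightarrow> real"
  assumes "bounded_linear \<phi>"
  obtains v where "\<And>x. \<phi> x = inner v x"
proof -
  interpret bounded_linear \<phi> by fact
  obtain K where K: "\<And>x. \<bar>\<phi> x\<bar> \<le> norm x * K"
    using bounded by auto
  define F where "F x = (norm x)\<^sup>2 / 2 - \<phi> x" for x
  have F_ge: "- (K\<^sup>2 / 2) \<le> F x" for x
  proof -
    have "0 \<le> (norm x - K)\<^sup>2" by simp
    then show ?thesis using K[of x] by (simp add: F_def power2_diff)
  qed
  define d where "d = Inf (range F)"
  have bdd: "bdd_below (range F)" using F_ge by (intro bdd_belowI2) auto
  have d_le: "d \<le> F x" for x unfolding d_def by (intro cInf_lower bdd) auto
  \<comment> \<open>The linear terms cancel, and the parallelogram law turns the rest into a squared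
    distance: near-minimizers of \<open>F\<close> are close to each other.\<close>
  have midpoint: "F x + F y - 2 * F ((1/2) *\<^sub>R (x + y)) = (dist x y)\<^sup>2 / 4" for x y
    unfolding F_def dist_norm power2_norm_eq_inner
    by (simp add: scaleR add inner_simps inner_commute field_simps)
  have "\<exists>x. F x < d + 1 / real (Suc k)" for k
  proof -
    have "Inf (range F) < d + 1 / real (Suc k)" by (simp add: d_def)
    then show ?thesis using cInf_lessD[of "range F"] by auto
  qed
  then obtain X where X: "\<And>k. F (X k) < d + 1 / real (Suc k)" by metis
  have "Cauchy X"
  proof (rule metric_CauchyI)
    fix e :: real assume e: "0 < e"
    \<comment> \<open>Two excesses of at most \<open>e\<^sup>2 / 8\<close> add up to the
      \<open>e\<^sup>2 / 4\<close> that \<open>midpoint\<close> compares with a quarter of the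
      squared distance.\<close>
    obtain N where N: "1 / real (Suc N) < e\<^sup>2 / 8"
      using e nat_approx_posE[of "e\<^sup>2 / 8"] by auto
    show "\<exists>N. \<forall>m\<ge>N. \<forall>n\<ge>N. dist (X m) (X n) < e"
    proof (intro exI allI impI)
      fix m n assume mn: "N \<le> m" "N \<le> n"
      have small: "F (X k) < d + e\<^sup>2 / 8" if "N \<le> k" for k
      proof -
        have "1 / real (Suc k) \<le> 1 / real (Suc N)" using that by (simp add: frac_le)
        then show ?thesis using X[of k] N by linarith
      qed
      have "(dist (X m) (X n))\<^sup>2 < e\<^sup>2"
        using midpoint[of "X m" "X n"] d_le[of "(1/2) *\<^sub>R (X m + X n)"] small[OF mn(1)] small[OF mn(2)]
        by linarith
      then show "dist (X m) (X n) < e" using e by (simp add: power2_less_imp_less)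
    qed
  qed
  then obtain v where v: "X \<longlonglongrightarrow> v" by (auto simp: Cauchy_convergent_iff convergent_def)
  have "(\<lambda>k. F (X k)) \<longlonglongrightarrow> F v"
    unfolding F_def by (intro tendsto_intros tendsto v) simp
  moreover have "(\<lambda>k. d + 1 / real (Suc k)) \<longlonglongrightarrow> d + 0"
    by (intro tendsto_intros LIMSEQ_Suc[OF lim_1_over_n])
  ultimately have "F v \<le> d + 0"
    by (rule LIMSEQ_le) (use X less_imp_le in blast)
  then have Fv: "F v \<le> d" by simp
  have "\<phi> x = inner v x" for x
  proof (cases "x = 0")
    case True then show ?thesis by (simp add: zero)
  next
    case False
    define c where "c = inner v x - \<phi> x"
    \<comment> \<open>This t minimizes the quadratic t c +
      \<open>t\<^sup>2 * (norm x)\<^sup>2 / 2\<close>, the change of \<open>F\<close> from v in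
      direction x; a nonzero c would push \<open>F\<close> below its infimum d.\<close>
    define t where "t = - c / (norm x)\<^sup>2"
    have "F (v + t *\<^sub>R x) - F v = t * c + t\<^sup>2 * (norm x)\<^sup>2 / 2"
      unfolding F_def c_def power2_norm_eq_inner
      by (simp add: add scaleR inner_simps inner_commute power2_eq_square field_simps)
    also have "\<dots> = - (c\<^sup>2 / (2 * (norm x)\<^sup>2))"
      using False by (simp add: t_def field_simps power2_eq_square)
    finally have "c\<^sup>2 / (2 * (norm x)\<^sup>2) \<le> 0" using Fv d_le[of "v + t *\<^sub>R x"] by linarith
    then have "c = 0" using False by (simp add: divide_le_0_iff)
    then show ?thesis by (simp add: c_def)
  qed
  then show thesis by (rule that)
qed

lemma cinner_zero [simp]: "cinner x 0 = 0" "cinner 0 x = 0"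
  by (simp_all add: cinner_rotate[of 0] cinner_rotate[of _ 0] Complex_eq_0 complex_vector.scale_zero_right)

lemma bounded_clinear_linear: "bounded_clinear T \<Longrightarrow> bounded_linear T"
  by (simp add: bounded_clinear_def)

lemma isometry_bounded_clinear: "isometry T \<Longrightarrow> bounded_clinear T"
  by (simp add: isometry_def)

lemma bounded_clinear_compose:
  "bounded_clinear S \<Longrightarrow> bounded_clinear T \<Longrightarrow> bounded_clinear (\<lambda>x. S (T x))"
  by (auto simp: bounded_clinear_def intro: bounded_linear_compose)

text \<open>This justifies the choice in \<open>cadjoint\<close>. The real Riesz theorem represents
  the real part of the functional; evaluating at \<open>\<i> *\<^sub>C x\<close> recovers the
  imaginary part.\<close>

lemma adjoint_exists:
  fixes T :: "'a::complex_hilbert \<Rightarrow> 'b::complex_inner"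
  assumes T: "bounded_clinear T"
  shows "\<exists>T'. \<forall>x y. cinner (T x) y = cinner x (T' y)"
proof -
  have "\<exists>v. \<forall>x. cinner (T x) y = cinner x v" for y
  proof -
    have "bounded_linear (\<lambda>x. inner y (T x))"
      using bounded_linear_compose[OF bounded_linear_inner_right bounded_clinear_linear[OF T]] .
    then obtain v where v: "\<And>x. inner y (T x) = inner v x"
      using riesz_representation by blast
    have "cinner y (T x) = cinner v x" for x
    proof (rule complex_eqI)
      show "Re (cinner y (T x)) = Re (cinner v x)"
        using v[of x] by (simp add: inner_Re_cinner)
      show "Im (cinner y (T x)) = Im (cinner v x)"
        using v[of "\<i> *\<^sub>C x"] T by (simp add: inner_Re_cinner bounded_clinear_def cinner_scaleC_right)
    qed
    then show ?thesis by (metis cinner_commute)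
  qed
  then show ?thesis by metis
qed

text \<open>A vector orthogonal to everything is orthogonal to itself. From here on kernels of
  adjoints are handled as orthogonal complements of ranges.\<close>

lemma ker_cadjoint:
  fixes T :: "'a::complex_hilbert \<Rightarrow> 'b::complex_inner"
  assumes "bounded_clinear T"
  shows "ker_op (cadjoint T) = {y. \<forall>x. cinner (T x) y = 0}"
proof -
  have adj: "cinner (T x) y = cinner x (cadjoint T y)" for x y
    using someI_ex[OF adjoint_exists[OF assms]] unfolding cadjoint_def by blast
  have "cadjoint T y = 0 \<longleftrightarrow> (\<forall>x. cinner x (cadjoint T y) = 0)" for y
  proof
    assume "\<forall>x. cinner x (cadjoint T y) = 0"
    then show "cadjoint T y = 0" by (metis cinner_self norm_eq_zero of_real_eq_0_iff power_eq_0_iff)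
  qed simp
  then show ?thesis by (simp add: ker_op_def adj)
qed

section \<open>Closed complex spans and orthogonality to them\<close>

lemma closed_cspan_minimal:
  assumes "A \<subseteq> S" "complex_vector.subspace S" "closed S"
  shows "closed_cspan A \<subseteq> S"
  unfolding closed_cspan_def
  by (intro closure_minimal complex_vector.span_minimal assms)

lemma closed_cspan_superset: "A \<subseteq> closed_cspan A"
  unfolding closed_cspan_def using complex_vector.span_superset closure_subset by blast

lemma bounded_linear_cinner_left: "bounded_linear (\<lambda>x. cinner (x::'a::complex_inner) v)"
proof -
  have "bounded_linear (\<lambda>x. cnj (cinner v x))"
    by (rule bounded_linear_compose[OF bounded_linear_cnj bounded_linear_cinner])
  then show ?thesis by (simp add: cinner_commute[symmetric])
qed

lemma orthogonal_closed_cspan: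
  "(\<forall>y\<in>closed_cspan A. cinner y f = 0) \<longleftrightarrow> (\<forall>y\<in>A. cinner y f = 0)"
proof
  assume A: "\<forall>y\<in>A. cinner y f = 0"
  have "closed_cspan A \<subseteq> {y. cinner y f = 0}"
  proof (rule closed_cspan_minimal)
    show "closed {y. cinner y f = 0}"
      by (intro closed_Collect_eq continuous_intros
          linear_continuous_on[OF bounded_linear_cinner_left])
    show "complex_vector.subspace {y. cinner y f = 0}"
      by (rule complex_vector.subspaceI)
         (auto simp: cinner_add_left cinner_scaleC_left)
  qed (use A in auto)
  then show "\<forall>y\<in>closed_cspan A. cinner y f = 0" by blast
qed (use closed_cspan_superset in blast)


section \<open>Invariance of the dimension under isometries\<close>

text \<open>Polarization gives the real inner product from norms; \<open>cinner_rotate\<close>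
  builds the complex one from two real ones.\<close>

lemma isometry_cinner:
  assumes "isometry V"
  shows "cinner (V x) (V y) = cinner x y"
proof -
  have V: "bounded_linear V" "\<And>a x. V (a *\<^sub>C x) = a *\<^sub>C V x" "\<And>x. norm (V x) = norm x"
    using assms by (auto simp: isometry_def bounded_clinear_def)
  have inner: "inner (V x) (V y) = inner x y" for x y
  proof -
    have "V (x + y) = V x + V y" using V(1) by (simp add: bounded_linear.linear linear_add)
    then have "(norm (V x + V y))\<^sup>2 = (norm (x + y))\<^sup>2" by (metis V(3))
    then show ?thesis
      using V(3)[of x] V(3)[of y]
      by (simp add: dot_norm)
  qed
  show ?thesis unfolding cinner_rotate V(2)[symmetric] inner ..
qed

lemma subspace_closure_subspace:
  fixes S :: "'a::real_normed_vector set"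
  assumes S: "subspace S"
  shows "subspace (closure S)"
proof (rule subspaceI)
  show "0 \<in> closure S" using subspace_0[OF S] closure_subset by blast
next
  fix x y assume "x \<in> closure S" "y \<in> closure S"
  then obtain X Y where "\<And>n. X n \<in> S" "X \<longlonglongrightarrow> x" "\<And>n. Y n \<in> S" "Y \<longlonglongrightarrow> y"
    unfolding closure_sequential by blast
  then show "x + y \<in> closure S"
    unfolding closure_sequential
    by (intro exI[of _ "\<lambda>n. X n + Y n"] conjI allI subspace_add[OF S] tendsto_add)
next
  fix c x assume "x \<in> closure S"
  then obtain X where "\<And>n. X n \<in> S" "X \<longlonglongrightarrow> x" unfolding closure_sequential by blast
  then show "c *\<^sub>R x \<in> closure S"
    unfolding closure_sequential
    by (intro exI[of _ "\<lambda>n. c *\<^sub>R X n"] conjI allI subspace_scale[OF S] tendsto_scaleR tendsto_const)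
qed

lemma isometry_closed_cspan_image:
  fixes V :: "'a::complex_hilbert \<Rightarrow> 'b::complex_hilbert"
  assumes "isometry V"
  shows "closed_cspan (V ` B) = V ` closed_cspan B"
proof -
  have V: "bounded_linear V" "\<And>a x. V (a *\<^sub>C x) = a *\<^sub>C V x" "\<And>x. norm (V x) = norm x"
    using assms by (auto simp: isometry_def bounded_clinear_def)
  interpret bounded_linear V by (rule V)
  have "module_hom scaleC scaleC V"
    unfolding module_hom_iff by (simp add: add V complex_vector.module_axioms)
  then have span: "cspan (V ` B) = V ` cspan B"
    using module_hom.span_image[of scaleC scaleC V B] unfolding cspan_def by simp
  show ?thesis unfolding closed_cspan_def span
  proof
    show "V ` closure (cspan B) \<subseteq> closure (V ` cspan B)"
      by (intro image_closure_subset continuous_on linear_continuous_on V)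
         (auto simp: closure_subset)
    have sub: "subspace (cspan B)"
      by (simp add: subspace_def scaleR_scaleC complex_vector.span_zero complex_vector.span_add
          complex_vector.span_scale)
    \<comment> \<open>An isometric image of a complete subspace is complete, hence closed, so it
      contains the closure on the left-hand side.\<close>
    have "complete (V ` closure (cspan B))"
      by (rule complete_isometric_image[of 1])
         (auto intro!: subspace_closure_subspace sub V(1) simp: V(3) complete_eq_closed)
    then show "closure (V ` cspan B) \<subseteq> V ` closure (cspan B)"
      by (intro closure_minimal image_mono closure_subset complete_imp_closed)
  qed
qed

lemma hdim_isometry_image:
  fixes V :: "'a::complex_hilbert \<Rightarrow> 'b::complex_hilbert"
  assumes "isometry V"
  shows "hdim (V ` G) = hdim G"
proof -
  have lin: "linear V" and norm: "\<And>x. norm (V x) = norm x"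
    using assms by (auto simp: isometry_def bounded_clinear_def bounded_linear.linear)
  have inj: "inj V"
    unfolding linear_injective_0[OF lin] by (metis norm norm_eq_zero)
  have basis: "orthonormal_basis (V ` B) (V ` G) \<longleftrightarrow> orthonormal_basis B G" for B
    unfolding orthonormal_basis_def isometry_closed_cspan_image[OF assms]
    by (simp add: norm isometry_cinner[OF assms] inj_image_eq_iff[OF inj] inj_eq[OF inj])
  have card: "finite (V ` B) \<longleftrightarrow> finite B" "card (V ` B) = card B" for B
    using inj by (auto simp: finite_image_iff card_image inj_on_subset)
  have image: "\<exists>B. B' = V ` B" if "orthonormal_basis B' (V ` G)" for B'
    using that closed_cspan_superset[of B'] by (auto simp: orthonormal_basis_def subset_image_iff)
  have "(\<exists>B'. orthonormal_basis B' (V ` G) \<and> d = (if finite B' then enat (card B') else \<infinity>)) \<longleftrightarrow>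
        (\<exists>B. orthonormal_basis B G \<and> d = (if finite B then enat (card B) else \<infinity>))" for d
    using basis card image by metis
  then show ?thesis unfolding hdim_def by simp
qed


section \<open>Square-summable families and reindexing\<close>

lemma bounded_linear_coord: "bounded_linear (\<lambda>f. coord f i)"
  by (rule bounded_linear_intro[where K = 1]) (auto simp: norm_coord_le)

text \<open>The squared norm of the remainder is the tail of a convergent sum, by
  \<open>norm_diff_finite_part\<close>.\<close>

lemma has_sum_single: "((\<lambda>i. ell2_single i (coord f i)) has_sum f) UNIV"
proof -
  have "((\<lambda>i. (norm (coord f i))\<^sup>2) has_sum (norm f)\<^sup>2) UNIV"
    unfolding norm_ell2_square by (rule has_sum_infsum) (rule ell2_summable)
  then have "((\<lambda>F. sqrt ((norm f)\<^sup>2 - (\<Sum>i\<in>F. (norm (coord f i))\<^sup>2))) \<longlongrightarrow> sqrt ((norm f)\<^sup>2 - (norm f)\<^sup>2))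
      (finite_subsets_at_top UNIV)"
    unfolding has_sum_def by (intro tendsto_intros)
  then have "((\<lambda>F. norm (f - (\<Sum>i\<in>F. ell2_single i (coord f i)))) \<longlongrightarrow> 0) (finite_subsets_at_top UNIV)"
    unfolding diff_self real_sqrt_zero
    by (rule Lim_transform_eventually)
       (auto intro!: eventually_finite_subsets_at_top_weakI simp flip: norm_diff_finite_part)
  then show ?thesis
    unfolding has_sum_def by (subst tendsto_dist_iff) (simp add: dist_norm norm_minus_commute)
qed

text \<open>Bounded maps carry the expansion of f into single coordinates to an expansion of the
  image. Later operator identities are thereby checked on single coordinates only.\<close>

lemma bounded_linear_ell2_eqI:
  assumes "bounded_linear S" "bounded_linear T"
    and "\<And>i x. S (ell2_single i x) = T (ell2_single i x)"
  shows "S f = T f"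
proof -
  have "((\<lambda>i. S (ell2_single i (coord f i))) has_sum S f) UNIV"
       "((\<lambda>i. T (ell2_single i (coord f i))) has_sum T f) UNIV"
    using has_sum_bounded_linear[OF assms(1) has_sum_single]
      has_sum_bounded_linear[OF assms(2) has_sum_single] by (simp_all add: o_def)
  then show ?thesis unfolding assms(3) by (rule has_sum_unique)
qed

lemma range_orthogonal_iff:
  assumes "bounded_linear T"
  shows "(\<forall>g. cinner (T g) f = 0) \<longleftrightarrow> (\<forall>i x. cinner (T (ell2_single i x)) f = 0)"
  using bounded_linear_ell2_eqI[of "\<lambda>g. cinner (T g) f" "\<lambda>_. 0"]
    bounded_linear_compose[OF bounded_linear_cinner_left assms] bounded_linear_zero
  by blast

text \<open>For injective \<iota>, \<open>push\<close> is the isometric embedding that fills the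
  remaining coordinates with 0, and \<open>pull\<close> is its adjoint. Along
  \<open>first_power\<close> they are the inverse of U_1 and U_1 itself, read on Taylor
  coefficients.\<close>

definition pull :: "('i \<Rightarrow> 'j) \<Rightarrow> ('j, 'e::complex_inner) ell2 \<Rightarrow> ('i, 'e) ell2" where
  "pull \<iota> f = Abs_ell2 (\<lambda>i. coord f (\<iota> i))"

definition push :: "('i \<Rightarrow> 'j) \<Rightarrow> ('i, 'e::complex_inner) ell2 \<Rightarrow> ('j, 'e) ell2" where
  "push \<iota> a = Abs_ell2 (\<lambda>j. if j \<in> range \<iota> then coord a (inv \<iota> j) else 0)"

context
  fixes \<iota> :: "'i \<Rightarrow> 'j"
  assumes inj: "inj \<iota>"
begin

lemma coord_pull: "coord (pull \<iota> f) i = coord f (\<iota> i)"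
proof -
  have "(\<lambda>j. (norm (coord f j))\<^sup>2) summable_on range \<iota>"
    by (rule summable_on_subset_banach[OF ell2_summable]) simp
  then have "(\<lambda>i. (norm (coord f (\<iota> i)))\<^sup>2) summable_on UNIV"
    by (simp add: summable_on_reindex[OF inj] o_def)
  then show ?thesis unfolding pull_def by (subst Abs_ell2_inverse) auto
qed

lemma coord_push: "coord (push \<iota> a) j = (if j \<in> range \<iota> then coord a (inv \<iota> j) else 0)"
proof -
  let ?g = "\<lambda>j. if j \<in> range \<iota> then coord a (inv \<iota> j) else 0"
  have "(\<lambda>j. (norm (?g j))\<^sup>2) summable_on range \<iota>"
    by (subst summable_on_reindex[OF inj]) (simp add: o_def inv_f_f[OF inj] ell2_summable)
  then have "(\<lambda>j. (norm (?g j))\<^sup>2) summable_on UNIV"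
    by (rule summable_on_cong_neutral[THEN iffD1, rotated -1]) auto
  then show ?thesis unfolding push_def by (subst Abs_ell2_inverse) auto
qed

lemma pull_push: "pull \<iota> (push \<iota> a) = a"
  by (rule ell2_eqI) (simp add: coord_pull coord_push inv_f_f[OF inj])

lemma push_pull: "(\<And>j. j \<notin> range \<iota> \<Longrightarrow> coord f j = 0) \<Longrightarrow> push \<iota> (pull \<iota> f) = f"
  by (rule ell2_eqI) (auto simp: coord_pull coord_push f_inv_into_f inv_f_f[OF inj])

lemma push_single: "push \<iota> (ell2_single i x) = ell2_single (\<iota> i) x"
  by (rule ell2_eqI) (auto simp: coord_push coord_single inv_f_f[OF inj])

lemma cinner_pull: "cinner (pull \<iota> f) a = cinner f (push \<iota> a)"
proof -
  have "cinner f (push \<iota> a) = (\<Sum>\<^sub>\<infinity>j\<in>range \<iota>. cinner (coord f j) (coord a (inv \<iota> j)))"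
    unfolding cinner_ell2_def
    by (rule infsum_cong_neutral) (auto simp: coord_push)
  also have "\<dots> = (\<Sum>\<^sub>\<infinity>i. cinner (coord f (\<iota> i)) (coord a i))"
    by (subst infsum_reindex[OF inj]) (simp add: o_def inv_f_f[OF inj])
  finally show ?thesis by (simp add: cinner_ell2_def coord_pull)
qed

lemma norm_push: "norm (push \<iota> a) = norm a"
proof -
  have "cinner (push \<iota> a) (push \<iota> a) = cinner a a"
    by (simp add: cinner_pull[symmetric] pull_push)
  then show ?thesis by (simp add: cinner_self del: of_real_power)
qed

lemma norm_pull_le: "norm (pull \<iota> f) \<le> norm f"
proof -
  have "(norm (pull \<iota> f))\<^sup>2 = inner f (push \<iota> (pull \<iota> f))"
    by (simp add: power2_norm_eq_inner inner_Re_cinner cinner_pull)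
  also have "\<dots> \<le> norm f * norm (pull \<iota> f)"
    using norm_cauchy_schwarz[of f "push \<iota> (pull \<iota> f)"] by (simp add: norm_push)
  finally show ?thesis
    by (cases "norm (pull \<iota> f) = 0") (auto simp: power2_eq_square)
qed

lemma bounded_clinear_pull: "bounded_clinear (pull \<iota> :: ('j, 'e::complex_inner) ell2 \<Rightarrow> _)"
  unfolding bounded_clinear_def
proof
  show "bounded_linear (pull \<iota> :: ('j, 'e) ell2 \<Rightarrow> _)"
    by (rule bounded_linear_intro[where K = 1])
       (auto intro!: ell2_eqI simp: coord_pull norm_pull_le)
qed (auto intro!: ell2_eqI simp: coord_pull)

lemma isometry_push: "isometry (push \<iota> :: ('i, 'e::complex_inner) ell2 \<Rightarrow> _)"
  unfolding isometry_def bounded_clinear_def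
proof (intro conjI)
  show "bounded_linear (push \<iota> :: ('i, 'e) ell2 \<Rightarrow> _)"
    by (rule bounded_linear_intro[where K = 1])
       (auto intro!: ell2_eqI simp: coord_push norm_push)
qed (auto intro!: ell2_eqI simp: coord_push norm_push complex_vector.scale_zero_right)

end


section \<open>The Hardy space in terms of Taylor coefficients\<close>

lemma bounded_linear_disc_series: "bounded_linear (\<lambda>a. disc_series a z)"
\<comment> \<open>Inside the disc the constant is a geometric series, since each coordinate of a is
  bounded by \<open>norm a\<close>; elsewhere \<open>disc_series\<close> is 0 and so is the
  constant.\<close>
proof (rule bounded_linear_intro[where K = "\<Sum>k. if norm z < 1 then norm z ^ k else 0"])
  fix a b :: "(nat, 'a) ell2" and r :: real
  show "disc_series (a + b) z = disc_series a z + disc_series b z" by (rule disc_series_add)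
  show "disc_series (r *\<^sub>R a) z = r *\<^sub>R disc_series a z"
    by (simp add: scaleR_scaleC disc_series_scaleC)
  show "norm (disc_series a z) \<le> norm a * (\<Sum>k. if norm z < 1 then norm z ^ k else 0)"
  proof (cases "norm z < 1")
    case True
    have s: "summable (\<lambda>k. norm a * norm z ^ k)"
      by (intro summable_mult summable_geometric) (use True in auto)
    have "norm (\<Sum>k. z ^ k *\<^sub>C coord a k) \<le> (\<Sum>k. norm a * norm z ^ k)"
      by (rule norm_suminf_le[OF _ s])
         (auto simp: norm_scaleC norm_power mult.commute[of "norm a"] intro!: mult_left_mono norm_coord_le)
    also have "\<dots> = norm a * (\<Sum>k. norm z ^ k)"
      by (rule suminf_mult) (use True in auto)
    finally show ?thesis using True by (simp add: disc_series_def)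
  qed (simp add: disc_series_def)
qed

lemma isometry_taylor: "isometry (taylor :: 'e::complex_hilbert hardy \<Rightarrow> _)"
  unfolding isometry_def bounded_clinear_def
  by (auto intro!: bounded_linear_intro[where K = 1] simp: norm_hardy_def)

lemma disc_series_single: "norm z < 1 \<Longrightarrow> disc_series (ell2_single m x) z = z ^ m *\<^sub>C x"
proof -
  assume "norm z < 1"
  then have "disc_series (ell2_single m x) z = (\<Sum>k. z ^ k *\<^sub>C (if k = m then x else 0))"
    by (simp add: disc_series_def coord_single)
  also have "\<dots> = (\<Sum>k\<in>{m}. z ^ k *\<^sub>C (if k = m then x else 0))"
    by (rule suminf_finite) (auto simp: complex_vector.scale_zero_right)
  finally show ?thesis by simp
qed


section \<open>Words and the values of the odometer map\<close>

definition last_power :: "nat \<Rightarrow> 'n::{finite,linorder} list" where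
  "last_power m = replicate m last_letter"

lemma inj_first_power: "inj first_power"
  by (rule injI) (metis first_power_def length_replicate)

lemma inj_last_power: "inj last_power"
  by (rule injI) (metis last_power_def length_replicate)

text \<open>Used with c the last letter for arguments of the odometer, and with c the first letter
  for the words it produces.\<close>

lemma replicate_or_split:
  obtains m where "w = replicate m c" | k i r where "w = replicate k c @ i # r" "i \<noteq> c"
proof (cases "\<forall>x\<in>set w. x = c")
  case True
  then show thesis using that(1) by (metis replicate_length_same)
next
  case False
  then obtain us i r where "w = us @ i # r" "i \<noteq> c" "\<forall>x\<in>set us. x = c"
    using split_list_first_prop[of w "\<lambda>x. x \<noteq> c"] by auto
  then show thesis using that(2) by (metis replicate_length_same)
qed

lemma split_neq_replicate: "i \<noteq> c \<Longrightarrow> replicate k c @ i # r \<noteq> replicate m c"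
  by (metis in_set_conv_decomp in_set_replicate)

lemma next_letter_neq_first: "j \<noteq> last_letter \<Longrightarrow> next_letter j \<noteq> first_letter"
proof -
  assume "j \<noteq> last_letter"
  then have "j < last_letter" unfolding last_letter_def by (simp add: order_less_le)
  then have "next_letter j \<in> {i. j < i}" unfolding next_letter_def by (intro Min_in) auto
  moreover have "first_letter \<le> j" unfolding first_letter_def by simp
  ultimately show ?thesis by auto
qed

lemma next_letter_surj:
  assumes "i \<noteq> first_letter"
  obtains j where "j \<noteq> last_letter" "next_letter j = i"
proof
  \<comment> \<open>The predecessor of i; the set is nonempty because i is not the first
    letter.\<close>
  define j where "j = Max {j. j < i}"
  have "first_letter < i"
    using assms unfolding first_letter_def by (simp add: order_less_le)
  then have "j \<in> {j. j < i}" unfolding j_def by (intro Max_in) auto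
  then have ji: "j < i" by simp
  have "i \<le> last_letter" unfolding last_letter_def by simp
  with ji show "j \<noteq> last_letter" by auto
  show "next_letter j = i" unfolding next_letter_def
  proof (rule Min_eqI)
    fix l assume "l \<in> {l. j < l}"
    then show "i \<le> l" using Max_ge[of "{j. j < i}" l] by (fastforce simp: j_def)
  qed (use ji in auto)
qed

text \<open>The empty word is the case m = 0, where \<open>shift 0\<close> is the identity, so the
  first two clauses of \<open>odometer_value\<close> merge.\<close>

lemma odometer_value_last_power: "odometer_value L (last_power m) \<eta> = shift m (L \<eta>)"
  by (auto simp: odometer_value_def last_power_def shift_def)

lemma odometer_value_split:
  assumes "j \<noteq> last_letter"
  shows "odometer_value L (replicate k last_letter @ j # r) \<eta> =
    ell2_single (first_power k @ next_letter j # r) \<eta>"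
proof -
  let ?w = "replicate k last_letter @ j # r"
  have "(LEAST k. k < length ?w \<and> ?w ! k \<noteq> last_letter) = k"
  proof (rule Least_equality)
    fix i assume "i < length ?w \<and> ?w ! i \<noteq> last_letter"
    then show "k \<le> i" by (cases "k \<le> i") (auto simp: nth_append)
  qed (use assms in \<open>auto simp: nth_append\<close>)
  then show ?thesis
    using assms by (simp add: odometer_value_def Let_def nth_append tensor_basis)
qed

section \<open>Orthogonality to the values of the odometer\<close>

lemma cinner_single_left: "cinner (ell2_single \<nu> x) f = cinner x (coord f \<nu>)"
proof -
  have "cinner (ell2_single \<nu> x) f = (\<Sum>\<^sub>\<infinity>i\<in>{\<nu>}. cinner x (coord f i))"
    unfolding cinner_ell2_def
    by (rule infsum_cong_neutral) (auto simp: coord_single)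
  then show ?thesis by simp
qed

lemma single_orthogonal_iff: "(\<forall>x. cinner (ell2_single \<nu> x) f = 0) \<longleftrightarrow> coord f \<nu> = 0"
proof
  assume "\<forall>x. cinner (ell2_single \<nu> x) f = 0"
  then have "cinner (coord f \<nu>) (coord f \<nu>) = 0" by (simp add: cinner_single_left)
  then show "coord f \<nu> = 0" by (simp add: cinner_self)
qed (simp add: cinner_single_left)

lemma odometer_values_orthogonal_iff:
  fixes L :: "'e::complex_inner \<Rightarrow> ('n::{finite,linorder}, 'e) fock_tensor"
  shows "(\<forall>\<mu> \<eta>. cinner (odometer_value L \<mu> \<eta>) f = 0) \<longleftrightarrow>
    (\<forall>\<nu>. \<nu> \<notin> range first_power \<longrightarrow> coord f \<nu> = 0) \<and> (\<forall>m \<eta>. cinner (shift m (L \<eta>)) f = 0)"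
    (is "?A \<longleftrightarrow> ?B \<and> ?C")
proof (intro iffI conjI allI impI; (elim conjE)?)
  fix m \<eta> assume ?A
  then show "cinner (shift m (L \<eta>)) f = 0" by (metis odometer_value_last_power)
next
  fix \<nu> :: "'n list" assume A: ?A and \<nu>: "\<nu> \<notin> range first_power"
  obtain k i r where i: "\<nu> = first_power k @ i # r" "i \<noteq> first_letter"
    by (rule replicate_or_split[of \<nu> first_letter]) (use \<nu> in \<open>auto simp: first_power_def\<close>)
  \<comment> \<open>Undoing the carry: the word with k copies of the last letter followed by j and r
    is sent to \<nu>.\<close>
  obtain j where "j \<noteq> last_letter" "next_letter j = i" using next_letter_surj[OF i(2)] .
  then have "cinner (ell2_single \<nu> x) f = 0" for x
    using A[rule_format, of "replicate k last_letter @ j # r" x] odometer_value_split[of j L k r x]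
    unfolding i(1) by (simp del: replicate.simps)
  then show "coord f \<nu> = 0" by (intro single_orthogonal_iff[THEN iffD1] allI)
next
  fix \<mu> :: "'n list" and \<eta> assume B: ?B and C: ?C
  show "cinner (odometer_value L \<mu> \<eta>) f = 0"
  proof (rule replicate_or_split[of \<mu> last_letter])
    fix m assume "\<mu> = replicate m last_letter"
    then show ?thesis using C odometer_value_last_power[of L m \<eta>] by (simp add: last_power_def)
  next
    fix k j r assume *: "\<mu> = replicate k last_letter @ j # r" "j \<noteq> last_letter"
    have "first_power k @ next_letter j # r \<notin> range first_power"
      using split_neq_replicate[OF next_letter_neq_first[OF *(2)]] by (auto simp: first_power_def)
    then show ?thesis using B by (simp add: * odometer_value_split single_orthogonal_iff[THEN iffD2])
  qed
qed

text \<open>Vanishing of coordinates is a closed condition, which gives one inclusion. Conversely, f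
  is the limit of its finite parts, whose terms either belong to the spanning set or vanish.\<close>

lemma M_perp_eq:
  "(M_perp :: ('n::{finite,linorder}, 'e::complex_inner) fock_tensor set) =
    {f. \<forall>\<nu>. \<nu> \<notin> range first_power \<longrightarrow> coord f \<nu> = 0}" (is "_ = ?S")
proof
  show "M_perp \<subseteq> ?S" unfolding M_perp_def
  proof (rule closed_cspan_minimal)
    have "closed (\<Inter>\<nu>\<in>- range first_power. {f :: ('n, 'e) fock_tensor. coord f \<nu> = 0})"
      by (intro closed_INT ballI closed_Collect_eq continuous_intros
          linear_continuous_on[OF bounded_linear_coord])
    moreover have "(\<Inter>\<nu>\<in>- range first_power. {f :: ('n, 'e) fock_tensor. coord f \<nu> = 0}) = ?S" by auto
    ultimately show "closed ?S" by simp
    show "complex_vector.subspace ?S"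
      by (rule complex_vector.subspaceI) (auto simp: complex_vector.scale_zero_right)
  qed (auto simp: tensor_basis coord_single)
next
  show "?S \<subseteq> M_perp"
  proof
    fix f :: "('n, 'e) fock_tensor" assume f: "f \<in> ?S"
    have "(\<Sum>i\<in>F. ell2_single i (coord f i))
        \<in> cspan {fock_basis (first_power m) \<otimes> \<eta> |m \<eta>. True}" for F :: "'n list set"
    proof (rule complex_vector.span_sum)
      fix i :: "'n list"
      show "ell2_single i (coord f i) \<in> cspan {fock_basis (first_power m) \<otimes> \<eta> |m \<eta>. True}"
      proof (cases "i \<in> range first_power")
        case True
        then show ?thesis by (auto intro!: complex_vector.span_base simp: tensor_basis)
      next
        case False
        then have "ell2_single i (coord f i) = 0"
          using f by (intro ell2_eqI) (simp add: coord_single)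
        then show ?thesis by (simp add: complex_vector.span_zero)
      qed
    qed
    then show "f \<in> M_perp"
      using has_sum_single[of f] unfolding has_sum_def M_perp_def closed_cspan_def
      by (intro Lim_in_closed_set[OF closed_closure always_eventually])
         (use closure_subset in \<open>auto\<close>)
  qed
qed

text \<open>\<open>E_space\<close> supplies orthogonality for m at least 1, and
  \<open>range L\<close> supplies the missing case m = 0.\<close>

lemma E_space_ominus_range:
  "E_space L \<ominus> range L = {f \<in> M_perp. \<forall>m \<eta>. cinner (shift m (L \<eta>)) f = 0}"
proof -
  have "(\<forall>y\<in>{shift p (L \<zeta>) |p \<zeta>. 1 \<le> p}. cinner y f = 0) \<and> (\<forall>y\<in>range L. cinner y f = 0) \<longleftrightarrow>
      (\<forall>m \<eta>. cinner (shift m (L \<eta>)) f = 0)" for f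
  proof -
    have "L \<eta> = shift 0 (L \<eta>)" for \<eta> by (simp add: shift_def)
    moreover have "m = 0 \<or> 1 \<le> m" for m :: nat by linarith
    ultimately show ?thesis by (auto; metis)
  qed
  then show ?thesis
    unfolding E_space_def ominus_def orthogonal_closed_cspan by blast
qed


section \<open>The multiplication operator of the symbol\<close>

text \<open>On the powers of the first letter, \<open>shift\<close> acts as the unilateral shift of
  coefficient sequences.\<close>

lemma pull_first_power_shift:
  fixes f :: "('n::{finite,linorder}, 'e::complex_inner) fock_tensor"
  shows "coord (pull first_power (shift m f)) k = (if m \<le> k then coord (pull first_power f) (k - m) else 0)"
proof (induction m arbitrary: k)
  case (Suc m)
  have "first_power (Suc k) = first_letter # (first_power k :: 'n list)" "first_power 0 = ([] :: 'n list)" for k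
    by (simp_all add: first_power_def)
  then show ?case
    using Suc[of "k - 1"] by (cases k) (auto simp: shift_def coord_pull[OF inj_first_power] coord_creation)
qed (simp add: shift_def)

text \<open>The function-side form of the unilateral shift: the first m coefficients vanish, and
  reindexing the others brings out the factor \<open>z ^ m\<close>.\<close>

lemma disc_series_shift:
  assumes "norm z < 1"
  shows "disc_series (pull first_power (shift m f)) z = z ^ m *\<^sub>C disc_series (pull first_power f) z"
proof -
  let ?g = "\<lambda>h k. z ^ k *\<^sub>C coord (pull first_power h) k"
  have "(\<Sum>k. ?g (shift m f) k) = (\<Sum>k. ?g (shift m f) (k + m)) + (\<Sum>k<m. ?g (shift m f) k)"
    by (rule suminf_split_initial_segment[OF disc_series_summable[OF assms]])
  also have "\<dots> = (\<Sum>k. z ^ m *\<^sub>C ?g f k)"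
    by (simp add: pull_first_power_shift complex_vector.scale_zero_right scaleC_scaleC power_add mult.commute)
  also have "\<dots> = z ^ m *\<^sub>C (\<Sum>k. ?g f k)"
    by (rule bounded_linear.suminf[OF bounded_linear_scaleC disc_series_summable[OF assms], symmetric])
  finally show ?thesis using assms by (simp add: disc_series_def)
qed

lemma U1_eq: "U1 f = Abs_hardy (disc_series (pull first_power f))"
  unfolding U1_def disc_series_def slice_def by (simp add: coord_pull[OF inj_first_power] cong: if_cong)

lemma symbol_eq: "norm z < 1 \<Longrightarrow> symbol L z \<eta> = disc_series (pull first_power (L \<eta>)) z"
  by (simp add: symbol_def symbol_coeff_def slice_def disc_series_def coord_pull[OF inj_first_power])

lemma odometer_map_single:
  "odometer_map L W \<Longrightarrow> W (ell2_single \<mu> \<eta>) = odometer_value L \<mu> \<eta>"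
  by (simp add: odometer_map_def tensor_basis[symmetric])

text \<open>At a fixed z both sides are bounded linear in the coefficient sequence, so monomials
  suffice. For the monomial with coefficient x at m, \<open>W\<close> yields
  \<open>shift m (L x)\<close>, whose compressed series is \<open>z ^ m\<close> times the symbol at
  x.\<close>

lemma taylor_mult_op_symbol:
  fixes L :: "'e::complex_hilbert \<Rightarrow> ('n::{finite,linorder}, 'e) fock_tensor"
  assumes L: "bounded_clinear L" and W: "odometer_map L W"
  shows "taylor (mult_op (symbol L) f) = pull first_power (W (push last_power (taylor f)))"
proof -
  let ?T = "\<lambda>a. pull first_power (W (push last_power a))"
  have Wl: "bounded_linear W" using W by (simp add: odometer_map_def bounded_clinear_def)
  have Ll: "bounded_linear L" using L by (simp add: bounded_clinear_def)
  have pull: "bounded_linear (pull (first_power :: nat \<Rightarrow> 'n list) :: (_, 'e) ell2 \<Rightarrow> _)"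
    by (rule bounded_clinear_linear[OF bounded_clinear_pull[OF inj_first_power]])
  have push: "bounded_linear (push (last_power :: nat \<Rightarrow> 'n list) :: (_, 'e) ell2 \<Rightarrow> _)"
    by (rule bounded_clinear_linear[OF isometry_bounded_clinear[OF isometry_push[OF inj_last_power]]])
  have "disc_series (?T a) z = symbol L z (disc_series a z)" if z: "norm z < 1" for a z
    unfolding symbol_eq[OF z]
  proof (rule bounded_linear_ell2_eqI[where S = "\<lambda>a. disc_series (?T a) z"
        and T = "\<lambda>a. disc_series (pull first_power (L (disc_series a z))) z"])
    show "bounded_linear (\<lambda>a. disc_series (?T a) z)"
      by (intro bounded_linear_compose[OF bounded_linear_disc_series] bounded_linear_compose[OF pull]
          bounded_linear_compose[OF Wl] push)
    show "bounded_linear (\<lambda>a. disc_series (pull first_power (L (disc_series a z))) z)"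
      by (intro bounded_linear_compose[OF bounded_linear_disc_series] bounded_linear_compose[OF pull]
          bounded_linear_compose[OF Ll] bounded_linear_disc_series)
    fix m x
    have "pull first_power (L (z ^ m *\<^sub>C x)) = z ^ m *\<^sub>C pull first_power (L x)"
      using bounded_clinear_compose[OF bounded_clinear_pull[OF inj_first_power] L]
      by (simp add: bounded_clinear_def)
    then show "disc_series (?T (ell2_single m x)) z
        = disc_series (pull first_power (L (disc_series (ell2_single m x) z))) z"
      by (simp add: push_single[OF inj_last_power] odometer_map_single[OF W] odometer_value_last_power
          disc_series_shift[OF z] disc_series_single[OF z] disc_series_scaleC)
  qed
  \<comment> \<open>The pointwise product is the series of a square-summable sequence, so
    \<open>Abs_hardy\<close> is applied inside its domain.\<close>
  then have "mult_op (symbol L) f = Abs_hardy (disc_series (?T (taylor f)))"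
    unfolding mult_op_def hardy_fun_taylor
    by (intro arg_cong[of _ _ Abs_hardy]) (auto simp: fun_eq_iff disc_series_def[of "?T _"])
  then show ?thesis by (simp add: taylor_Abs)
qed

text \<open>Linearity and the norm bound of the compression of \<open>W\<close> transfer back
  through \<open>taylor\<close>, which is linear, injective and isometric.\<close>

lemma bounded_clinear_mult_op_symbol:
  fixes L :: "'e::complex_hilbert \<Rightarrow> ('n::{finite,linorder}, 'e) fock_tensor"
  assumes L: "bounded_clinear L" and W: "odometer_map L W"
  shows "bounded_clinear (mult_op (symbol L))"
proof -
  let ?S = "\<lambda>f. pull first_power (W (push last_power (taylor f)))"
  have "bounded_clinear ?S"
    using W unfolding odometer_map_def
    by (intro bounded_clinear_compose[OF bounded_clinear_pull[OF inj_first_power]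
        bounded_clinear_compose[OF _ bounded_clinear_compose[OF
          isometry_bounded_clinear[OF isometry_push[OF inj_last_power]]
          isometry_bounded_clinear[OF isometry_taylor]]]]) simp
  then have S: "bounded_linear ?S" "\<And>a f. ?S (a *\<^sub>C f) = a *\<^sub>C ?S f"
    by (auto simp: bounded_clinear_def)
  note eq = taylor_mult_op_symbol[OF L W, symmetric]
  note S = S[unfolded eq]
  obtain K where K: "\<And>f. norm (mult_op (symbol L) f) \<le> norm f * K"
    using bounded_linear.bounded[OF S(1)] unfolding norm_hardy_def by blast
  have "bounded_linear (mult_op (symbol L))"
    using K linear_add[OF bounded_linear.linear[OF S(1)]] linear_scale[OF bounded_linear.linear[OF S(1)]]
    by (intro bounded_linear_intro[where K = K] taylor_inject) simp_all
  then show ?thesis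
    unfolding bounded_clinear_def by (auto intro!: taylor_inject simp: S(2))
qed

theorem theorem7p4:
  fixes L :: "'e::complex_hilbert \<Rightarrow> ('n::{finite,linorder}, 'e) fock_tensor"
    and W :: "('n, 'e) fock_tensor \<Rightarrow> ('n, 'e) fock_tensor"
    and \<Theta> :: "complex \<Rightarrow> 'e \<Rightarrow> 'e"
  assumes "separable_space (euclidean :: 'e topology)"
    and "bounded_clinear L"
    and "odometer_map L W"
    and "isometry W"
    and "\<Theta> = symbol L"
  shows "ker_op (cadjoint (mult_op \<Theta>)) = U1 ` (E_space L \<ominus> range L)
       \<and> shift_mult W = shift_mult (mult_op \<Theta>)"
proof -
  note L = assms(2) and W = assms(3)
  let ?J = "push first_power :: (nat, 'e) ell2 \<Rightarrow> ('n, 'e) fock_tensor"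
  \<comment> \<open>The adjoint of U_1 as an isometry into the full tensor product: its range is
    \<open>M_perp\<close>, where it inverts \<open>U1\<close>.\<close>
  let ?V = "\<lambda>g. ?J (taylor g)"
  let ?E = "E_space L \<ominus> range L"
  have Wl: "bounded_clinear W" using W by (simp add: odometer_map_def)
  have V: "isometry ?V"
    using bounded_clinear_compose[OF isometry_bounded_clinear[OF isometry_push[OF inj_first_power]]
        isometry_bounded_clinear[OF isometry_taylor]]
    by (simp add: isometry_def norm_push[OF inj_first_power] norm_hardy_def)
  have V_M: "?V g \<in> M_perp" for g :: "'e hardy"
    by (simp add: M_perp_eq coord_push[OF inj_first_power])
  have V_U1: "?V (U1 f) = f" if "f \<in> M_perp" for f :: "('n, 'e) fock_tensor"
    using that by (simp add: U1_eq taylor_Abs M_perp_eq push_pull[OF inj_first_power])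
  have U1_V: "U1 (?V g) = g" for g :: "'e hardy"
    by (simp add: U1_eq pull_push[OF inj_first_power] hardy_fun_taylor[symmetric] hardy_fun_inverse)
  have ker_W: "ker_op (cadjoint W) = ?E"
    unfolding ker_cadjoint[OF Wl] range_orthogonal_iff[OF bounded_clinear_linear[OF Wl]]
      odometer_map_single[OF W] odometer_values_orthogonal_iff E_space_ominus_range M_perp_eq
    by blast
  \<comment> \<open>Moving \<open>pull\<close> across the inner product replaces g by
    \<open>?V g\<close>. Only powers of the last letter are tested; the other conditions for
    \<open>?E\<close> say that \<open>?V g\<close> lies in \<open>M_perp\<close>, which holds by
    \<open>V_M\<close>.\<close>
  have "(\<forall>f. cinner (mult_op \<Theta> f) g = 0) \<longleftrightarrow> ?V g \<in> ?E" for g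
  proof -
    have "(\<forall>f. cinner (mult_op \<Theta> f) g = 0) \<longleftrightarrow> (\<forall>f. cinner (W (push last_power (taylor f))) (?V g) = 0)"
      by (simp add: cinner_hardy_def assms(5) taylor_mult_op_symbol[OF L W] cinner_pull[OF inj_first_power])
    \<comment> \<open>Every square-summable sequence is the Taylor sequence of a Hardy
      function.\<close>
    also have "\<dots> \<longleftrightarrow> (\<forall>a. cinner (W (push last_power a)) (?V g) = 0)"
      by (metis taylor_Abs)
    also have "\<dots> \<longleftrightarrow> (\<forall>m x. cinner (W (push last_power (ell2_single m x))) (?V g) = 0)"
      by (rule range_orthogonal_iff[OF bounded_clinear_linear[OF bounded_clinear_compose[OF Wl
            isometry_bounded_clinear[OF isometry_push[OF inj_last_power]]]]])
    also have "\<dots> \<longleftrightarrow> ?V g \<in> ?E"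
      by (simp add: push_single[OF inj_last_power] odometer_map_single[OF W]
          odometer_value_last_power E_space_ominus_range V_M)
    finally show ?thesis .
  qed
  then have ker_M: "ker_op (cadjoint (mult_op \<Theta>)) = {g. ?V g \<in> ?E}"
    using ker_cadjoint[OF bounded_clinear_mult_op_symbol[OF L W]] by (simp add: assms(5))
  have E_M: "?E \<subseteq> M_perp" by (auto simp: E_space_ominus_range)
  have V_U1_E: "?V (U1 f) = f" if "f \<in> ?E" for f
    using that E_M by (intro V_U1) blast
  have "{g. ?V g \<in> ?E} = U1 ` ?E"
  proof (intro equalityI subsetI)
    fix g assume "g \<in> {g. ?V g \<in> ?E}"
    then show "g \<in> U1 ` ?E" by (intro image_eqI[of _ _ "?V g"]) (simp_all only: U1_V mem_Collect_eq)
  qed (auto simp only: V_U1_E mem_Collect_eq)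
  \<comment> \<open>Thus \<open>?V\<close> maps the kernel of the adjoint of M_\<Theta>
    isometrically onto that of \<open>W\<close>, which makes the multiplicities equal.\<close>
  moreover from this have "?V ` {g. ?V g \<in> ?E} = ?E"
    by (simp only: image_image V_U1_E image_ident cong: image_cong)
  ultimately show ?thesis
    unfolding shift_mult_def ker_W ker_M using hdim_isometry_image[OF V] by metis
qed

end
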